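(* Let $\pi$ be a permutation with Füredi–Hajnal limit $c_\pi$, and let $P\subset[0,1]^2$ be a set of $n$ points in general position that avoids $\pi$. Then $P$ has a distance-balanced $10c_\pi$-wide merge sequence.
   Context: General position: no two points share an $x$- or $y$-coordinate; $P$ avoids $\pi$ if the permutation obtained by listing the points by increasing $x$ and recording ranks of $y$-coordinates has no subsequence order-isomorphic to $\pi$. Füredi–Hajnal limit: $\mathrm{ex}_\pi(n)$ is the maximum number of 1s in an $n\times n$ 0-1 matrix from which the permutation matrix of $\pi$ cannot be obtained by deleting rows/columns and turning 1s into 0s; $c_\pi=\lim_n \mathrm{ex}_\pi(n)/n$. Merge sequences: a rectangle family is a set of axis-parallel rectangles (points are degenerate rectangles); merging two rectangles replaces them by their bounding box; a merge sequence of $P$ is $\mathscr{R}_1=P,\dots,\mathscr{R}_n$ with $\mathscr{R}_n$ a single rectangle and each $\mathscr{R}_{i+1}$ obtained from $\mathscr{R}_i$ by merging two rectangles. Two rectangles are homogeneous if both their $x$-projections and $y$-projections are disjoint; the red graph of $\mathscr{R}_i$ joins distinct non-homogeneous rectangles; the sequence is $d$-wide if every red graph has maximum degree $<d$. Griddings: a partition of $[0,1]$ is a tuple of pairwise disjoint intervals $I_1<I_2<\dots<I_s$ with union $[0,1]$. An $r\times s$ gridding of $[0,1]^2$ is a pair of partitions $(I_1,\dots,I_r)$, $(J_1,\dots,J_s)$ of $[0,1]$; $I_x$ is the $x$-th column, $J_y$ the $y$-th row, $I_x\times J_y$ a cell. A $d$-wide merge sequence $\mathscr{R}_1,\dots,\mathscr{R}_n$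 of $P\subset[0,1]^2$, augmented with griddings $G_1,\dots,G_n$, is distance-balanced if, writing $p_i$ and $q_i$ for the numbers of columns and rows of $G_i$, for every $i$: (a) each row and each column of $G_i$ contains at most $d/2$ non-empty cells (cells containing a point of $P$); (b) each rectangle of $\mathscr{R}_i$ is contained in a single cell of $G_i$ and has width $<20/p_i$ and height $<20/q_i$; (c) each column of $G_i$ of width $>40/p_i$ contains at most $d/2$ points of $P$, and each row of $G_i$ of height $>40/q_i$ contains at most $d/2$ points of $P$; (d) $\frac{9}{40}d(\max(p_i,q_i)-1)\le n-i+1\le \frac12 d\min(p_i,q_i)$. *)

theory Defs
  imports
    "HOL-Analysis.Analysis"
    "HOL-Combinatorics.Permutations"
    "HOL-Library.Sublist"
begin

text \<open>
  A permutation of length \<open>k\<close> is a function \<open>\<pi>\<close> with \<open>\<pi> permutes {..<k}\<close>; its one-line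
  notation is \<open>map \<pi> [0..<k]\<close>. Ranks and matrix indices are likewise 0-based.
\<close>

type_synonym point = "real \<times> real"

subsection \<open>Pattern avoidance for point sets\<close>

definition general_position :: "point set \<Rightarrow> bool" where
  "general_position P \<longleftrightarrow> inj_on fst P \<and> inj_on snd P"

definition perm_of_points :: "point set \<Rightarrow> nat list" where
  "perm_of_points P =
     map (\<lambda>p. card {q \<in> P. snd q < snd p}) (sorted_key_list_of_set fst P)"

definition order_isomorphic :: "nat list \<Rightarrow> nat list \<Rightarrow> bool" where
  "order_isomorphic xs ys \<longleftrightarrow> length xs = length ys \<and>
     (\<forall>i<length xs. \<forall>j<length xs. xs ! i < xs ! j \<longleftrightarrow> ys ! i < ys ! j)"

definition avoids :: "point set \<Rightarrow> nat \<Rightarrow> (nat \<Rightarrow> nat) \<Rightarrow> bool" where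
  "avoids P k \<pi> \<longleftrightarrow>
     \<not> (\<exists>ys. subseq ys (perm_of_points P) \<and> order_isomorphic ys (map \<pi> [0..<k]))"

subsection \<open>The Fueredi-Hajnal limit\<close>

text \<open>
  An \<open>n \<times> n\<close> 0-1 matrix is a predicate on index pairs, of which only the indices below \<open>n\<close> matter.
\<close>

definition ones :: "nat \<Rightarrow> (nat \<Rightarrow> nat \<Rightarrow> bool) \<Rightarrow> nat" where
  "ones n A = card {(i, j). i < n \<and> j < n \<and> A i j}"

text \<open>
  The increasing maps \<open>r\<close> and \<open>c\<close> select the rows and columns that are not deleted; the
  implication allows surplus 1s, which are then turned into 0s. The permutation matrix has its
  1s at the positions \<open>(i, \<pi> i)\<close>.
\<close>

definition matrix_contains :: "nat \<Rightarrow> (nat \<Rightarrow> nat \<Rightarrow> bool) \<Rightarrow> nat \<Rightarrow> (nat \<Rightarrow> nat) \<Rightarrow> bool" where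
  "matrix_contains n A k \<pi> \<longleftrightarrow>
     (\<exists>r c. strict_mono_on {..<k} r \<and> r ` {..<k} \<subseteq> {..<n} \<and>
            strict_mono_on {..<k} c \<and> c ` {..<k} \<subseteq> {..<n} \<and>
            (\<forall>i<k. \<forall>j<k. j = \<pi> i \<longrightarrow> A (r i) (c j)))"

definition ex_perm :: "nat \<Rightarrow> (nat \<Rightarrow> nat) \<Rightarrow> nat \<Rightarrow> nat" where
  "ex_perm k \<pi> n = Max {ones n A | A. \<not> matrix_contains n A k \<pi>}"

definition fh_limit :: "nat \<Rightarrow> (nat \<Rightarrow> nat) \<Rightarrow> real" where
  "fh_limit k \<pi> = lim (\<lambda>n. real (ex_perm k \<pi> n) / real n)"

subsection \<open>Merge sequences\<close>

definition bounding_box :: "point set \<Rightarrow> point set" where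
  "bounding_box S = {Inf (fst ` S)..Sup (fst ` S)} \<times> {Inf (snd ` S)..Sup (snd ` S)}"

definition merge_step :: "point set set \<Rightarrow> point set set \<Rightarrow> bool" where
  "merge_step F F' \<longleftrightarrow>
     (\<exists>R\<in>F. \<exists>S\<in>F. R \<noteq> S \<and> F' = insert (bounding_box (R \<union> S)) (F - {R, S}))"

text \<open>
  Only the indices \<open>1, \<dots>, card P\<close> of a sequence matter. Every member of the families is
  automatically a rectangle: they arise from points by taking bounding boxes.
\<close>

definition merge_sequence :: "point set \<Rightarrow> (nat \<Rightarrow> point set set) \<Rightarrow> bool" where
  "merge_sequence P \<R> \<longleftrightarrow>
     \<R> 1 = (\<lambda>p. {p}) ` P \<and>
     (\<exists>R. \<R> (card P) = {R}) \<and>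
     (\<forall>i\<in>{1..<card P}. merge_step (\<R> i) (\<R> (Suc i)))"

definition homogeneous :: "point set \<Rightarrow> point set \<Rightarrow> bool" where
  "homogeneous R S \<longleftrightarrow> fst ` R \<inter> fst ` S = {} \<and> snd ` R \<inter> snd ` S = {}"

definition red_degree :: "point set set \<Rightarrow> point set \<Rightarrow> nat" where
  "red_degree F R = card {S \<in> F. S \<noteq> R \<and> \<not> homogeneous R S}"

definition wide :: "real \<Rightarrow> point set \<Rightarrow> (nat \<Rightarrow> point set set) \<Rightarrow> bool" where
  "wide d P \<R> \<longleftrightarrow> (\<forall>i\<in>{1..card P}. \<forall>R\<in>\<R> i. real (red_degree (\<R> i) R) < d)"

subsection \<open>Griddings and distance-balanced merge sequences\<close>

text \<open>
  The intervals of a partition may be open, closed, half-open or single points, but not empty.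
  Being ordered, they are pairwise disjoint.
\<close>

definition unit_partition :: "real set list \<Rightarrow> bool" where
  "unit_partition Is \<longleftrightarrow>
     (\<forall>I\<in>set Is. is_interval I \<and> I \<noteq> {}) \<and>
     sorted_wrt (\<lambda>I J. \<forall>x\<in>I. \<forall>y\<in>J. x < y) Is \<and>
     \<Union> (set Is) = {0..1}"

text \<open>The first component lists the columns, the second one the rows.\<close>

type_synonym gridding = "real set list \<times> real set list"

definition is_gridding :: "gridding \<Rightarrow> bool" where
  "is_gridding G \<longleftrightarrow> unit_partition (fst G) \<and> unit_partition (snd G)"

abbreviation grid_columns :: "gridding \<Rightarrow> real set set" where
  "grid_columns G \<equiv> set (fst G)"

abbreviation grid_rows :: "gridding \<Rightarrow> real set set" where
  "grid_rows G \<equiv> set (snd G)"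

abbreviation num_columns :: "gridding \<Rightarrow> nat" where
  "num_columns G \<equiv> length (fst G)"

abbreviation num_rows :: "gridding \<Rightarrow> nat" where
  "num_rows G \<equiv> length (snd G)"

definition extent :: "real set \<Rightarrow> real" where
  "extent I = Sup I - Inf I"

definition distance_balanced ::
  "real \<Rightarrow> point set \<Rightarrow> (nat \<Rightarrow> point set set) \<Rightarrow> (nat \<Rightarrow> gridding) \<Rightarrow> bool" where
  "distance_balanced d P \<R> G \<longleftrightarrow>
     (\<forall>i\<in>{1..card P}.
        let p = real (num_columns (G i)); q = real (num_rows (G i)) in
        is_gridding (G i) \<and>
        (\<forall>I\<in>grid_columns (G i). real (card {J \<in> grid_rows (G i). (I \<times> J) \<inter> P \<noteq> {}}) \<le> d / 2) \<and>
        (\<forall>J\<in>grid_rows (G i). real (card {I \<in> grid_columns (G i). (I \<times> J) \<inter> P \<noteq> {}}) \<le> d / 2) \<and>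
        (\<forall>R\<in>\<R> i. (\<exists>I\<in>grid_columns (G i). \<exists>J\<in>grid_rows (G i). R \<subseteq> I \<times> J) \<and>
                   extent (fst ` R) < 20 / p \<and> extent (snd ` R) < 20 / q) \<and>
        (\<forall>I\<in>grid_columns (G i). extent I > 40 / p \<longrightarrow> real (card {z \<in> P. fst z \<in> I}) \<le> d / 2) \<and>
        (\<forall>J\<in>grid_rows (G i). extent J > 40 / q \<longrightarrow> real (card {z \<in> P. snd z \<in> J}) \<le> d / 2) \<and>
        9 / 40 * d * (max p q - 1) \<le> real (card P) - real i + 1 \<and>
        real (card P) - real i + 1 \<le> 1 / 2 * d * min p q)"

end

(*
  The invariant is a family F of m rectangles, each inside a cell of a gridding with p columns and
  q rows, such that every column and every row contains at most 5c rectangles, where c is the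
  Fueredi-Hajnal limit, and 9/4 c (max p q - 1) <= m. A rectangle is then non-homogeneous only to
  rectangles of its own column or row, fewer than 10c in total. Since the pattern of non-empty
  cells avoids pi, there are at most c max p q of them, so some narrow cell contains two
  rectangles, which are merged. When m gets too small for the number of columns, averaging over
  adjacent pairs yields two columns that can be united: few rectangles, small total width.

  That c is finite and bounds ex(n)/n for every n, not only in the limit, follows from the theorem
  of Marcus and Tardos and the superadditivity of ex.
*)
theory Submission imports Defs
begin


lemma finite_ones: "finite {(i, j). i < n \<and> j < (n::nat) \<and> A i j}"
  by (rule finite_subset[of _ "{..<n} \<times> {..<n}"]) auto

lemma ones_le_square: "ones n A \<le> n * n"
proof -
  have "ones n A \<le> card ({..<n} \<times> {..<n})"
    unfolding ones_def by (intro card_mono) auto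
  then show ?thesis by simp
qed

lemma finite_ones_avoiding: "finite {ones n A | A. \<not> matrix_contains n A k \<pi>}"
  by (rule finite_subset[of _ "{..n * n}"]) (auto simp: ones_le_square)

lemma ones_le_ex_perm: "\<not> matrix_contains n A k \<pi> \<Longrightarrow> ones n A \<le> ex_perm k \<pi> n"
  unfolding ex_perm_def by (rule Max_ge[OF finite_ones_avoiding]) auto

lemma ex_perm_attained:
  assumes "\<pi> permutes {..<k}" and "k > 0"
  obtains A where "\<not> matrix_contains n A k \<pi>" "ex_perm k \<pi> n = ones n A"
proof -
  have "\<not> matrix_contains n (\<lambda>_ _. False) k \<pi>"
    using assms permutes_in_image[OF assms(1)] by (auto simp: matrix_contains_def)
  then have "{ones n A | A. \<not> matrix_contains n A k \<pi>} \<noteq> {}" by blast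
  from Max_in[OF finite_ones_avoiding this] obtain A
    where "\<not> matrix_contains n A k \<pi>" "ex_perm k \<pi> n = ones n A"
    unfolding ex_perm_def by auto
  then show ?thesis using that by blast
qed

lemma matrix_contains_transpose:
  assumes "\<pi> permutes {..<k}" and "matrix_contains n (\<lambda>i j. A j i) k (inv \<pi>)"
  shows "matrix_contains n A k \<pi>"
proof -
  obtain r c where rc: "strict_mono_on {..<k} r" "r ` {..<k} \<subseteq> {..<n}"
      "strict_mono_on {..<k} c" "c ` {..<k} \<subseteq> {..<n}"
    and A: "\<forall>i<k. \<forall>j<k. j = inv \<pi> i \<longrightarrow> A (c j) (r i)"
    using assms(2) unfolding matrix_contains_def by blast
  have "A (c i) (r (\<pi> i))" if "i < k" for i
    using A[rule_format, of "\<pi> i" i] that permutes_in_image[OF assms(1)]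
      permutes_inverses(2)[OF assms(1)] by simp
  then show ?thesis
    unfolding matrix_contains_def using rc by blast
qed

subsection \<open>Superadditivity\<close>

lemma block_diagonal_contains:
  assumes "matrix_contains (m + n) M k \<pi>"
    and "k > 0" and "\<pi> permutes {..<k}"
    and M: "\<And>i j. M i j \<longleftrightarrow> (i < m \<and> j < m \<and> A i j) \<or> (m \<le> i \<and> m \<le> j \<and> B (i - m) (j - m))"
    and "\<pi> (k - 1) \<le> \<pi> 0"
  shows "matrix_contains m A k \<pi> \<or> matrix_contains n B k \<pi>"
proof -
  obtain r c where r: "strict_mono_on {..<k} r" "r ` {..<k} \<subseteq> {..<m + n}"
    and c: "strict_mono_on {..<k} c" "c ` {..<k} \<subseteq> {..<m + n}"
    and "\<forall>i<k. \<forall>j<k. j = \<pi> i \<longrightarrow> M (r i) (c j)"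
    using assms(1) unfolding matrix_contains_def by blast
  moreover have pk: "\<pi> i < k" if "i < k" for i
    using permutes_in_image[OF assms(3)] that by simp
  ultimately have Mr: "M (r i) (c (\<pi> i))" if "i < k" for i
    using that by blast
  have r_mono: "r i \<le> r j" if "i \<le> j" "j < k" for i j
    using strict_mono_onD[OF r(1), of i j] that by (cases "i = j") auto
  have c_mono: "c i \<le> c j" if "i \<le> j" "j < k" for i j
    using strict_mono_onD[OF c(1), of i j] that by (cases "i = j") auto
  have surj: "\<exists>i<k. j = \<pi> i" if "j < k" for j
    using permutes_image[OF assms(3)] that by (metis imageE lessThan_iff)
  show ?thesis
  proof (cases "r 0 < m")
    case True
    then have "c (\<pi> 0) < m" using Mr[of 0] M assms(2) by auto
    then have "c (\<pi> (k - 1)) < m"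
      using c_mono[OF assms(5) pk[of 0]] assms(2) by simp
    then have "r (k - 1) < m" using Mr[of "k - 1"] M assms(2) by auto
    then have rm: "r i < m" if "i < k" for i
      using r_mono[of i "k - 1"] that by linarith
    then have A: "c (\<pi> i) < m \<and> A (r i) (c (\<pi> i))" if "i < k" for i
      using Mr[OF that] M that by fastforce
    then have "c j < m" if "j < k" for j using surj[OF that] by auto
    then have "matrix_contains m A k \<pi>"
      unfolding matrix_contains_def using r(1) c(1) A rm by (intro exI[of _ r] exI[of _ c]) auto
    then show ?thesis ..
  next
    case False
    then have rm: "m \<le> r i" if "i < k" for i
      using r_mono[of 0 i] that by simp
    then have B: "m \<le> c (\<pi> i) \<and> B (r i - m) (c (\<pi> i) - m)" if "i < k" for i
      using Mr[OF that] M rm[OF that] by auto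
    then have cm: "m \<le> c j" if "j < k" for j using surj[OF that] by auto
    have "strict_mono_on {..<k} (\<lambda>i. r i - m)" "strict_mono_on {..<k} (\<lambda>i. c i - m)"
      using r(1) c(1) rm cm by (auto simp: strict_mono_on_def intro!: diff_less_mono)
    moreover have "r i - m < n" "c i - m < n" if "i < k" for i
      using r(2) c(2) that rm[OF that] cm[OF that] by fastforce+
    ultimately have "matrix_contains n B k \<pi>"
      unfolding matrix_contains_def using B
      by (intro exI[of _ "\<lambda>i. r i - m"] exI[of _ "\<lambda>i. c i - m"]) auto
    then show ?thesis ..
  qed
qed

lemma block_antidiagonal_contains:
  assumes "matrix_contains (m + n) M k \<pi>"
    and "k > 0" and "\<pi> permutes {..<k}"
    and M: "\<And>i j. M i j \<longleftrightarrow> (i < m \<and> n \<le> j \<and> j < m + n \<and> A i (j - n)) \<or> (m \<le> i \<and> j < n \<and> B (i - m) j)"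
    and "\<pi> 0 < \<pi> (k - 1)"
  shows "matrix_contains m A k \<pi> \<or> matrix_contains n B k \<pi>"
proof -
  obtain r c where r: "strict_mono_on {..<k} r" "r ` {..<k} \<subseteq> {..<m + n}"
    and c: "strict_mono_on {..<k} c" "c ` {..<k} \<subseteq> {..<m + n}"
    and "\<forall>i<k. \<forall>j<k. j = \<pi> i \<longrightarrow> M (r i) (c j)"
    using assms(1) unfolding matrix_contains_def by blast
  moreover have pk: "\<pi> i < k" if "i < k" for i
    using permutes_in_image[OF assms(3)] that by simp
  ultimately have Mr: "M (r i) (c (\<pi> i))" if "i < k" for i
    using that by blast
  have r_mono: "r i \<le> r j" if "i \<le> j" "j < k" for i j
    using strict_mono_onD[OF r(1), of i j] that by (cases "i = j") auto
  have c_mono: "c i \<le> c j" if "i \<le> j" "j < k" for i j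
    using strict_mono_onD[OF c(1), of i j] that by (cases "i = j") auto
  have surj: "\<exists>i<k. j = \<pi> i" if "j < k" for j
    using permutes_image[OF assms(3)] that by (metis imageE lessThan_iff)
  show ?thesis
  proof (cases "r 0 < m")
    case True
    then have "n \<le> c (\<pi> 0)" using Mr[of 0] M assms(2) by auto
    then have "n \<le> c (\<pi> (k - 1))"
      using c_mono[OF less_imp_le[OF assms(5)] pk[of "k - 1"]] assms(2) by simp
    then have "r (k - 1) < m" using Mr[of "k - 1"] M assms(2) by auto
    then have rm: "r i < m" if "i < k" for i
      using r_mono[of i "k - 1"] that by linarith
    then have A: "n \<le> c (\<pi> i) \<and> c (\<pi> i) < m + n \<and> A (r i) (c (\<pi> i) - n)" if "i < k" for i
      using Mr[OF that] M that by fastforce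
    then have cm: "n \<le> c j \<and> c j < m + n" if "j < k" for j using surj[OF that] by auto
    then have "strict_mono_on {..<k} (\<lambda>i. c i - n)"
      using c(1) by (auto simp: strict_mono_on_def intro!: diff_less_mono)
    moreover have "c j - n < m" if "j < k" for j
      using cm[OF that] by auto
    ultimately have "matrix_contains m A k \<pi>"
      unfolding matrix_contains_def using r(1) A rm
      by (intro exI[of _ r] exI[of _ "\<lambda>i. c i - n"]) auto
    then show ?thesis ..
  next
    case False
    then have rm: "m \<le> r i" if "i < k" for i
      using r_mono[of 0 i] that by simp
    then have B: "c (\<pi> i) < n \<and> B (r i - m) (c (\<pi> i))" if "i < k" for i
      using Mr[OF that] M rm[OF that] by auto
    then have cm: "c j < n" if "j < k" for j using surj[OF that] by auto
    have "strict_mono_on {..<k} (\<lambda>i. r i - m)"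
      using r(1) rm by (auto simp: strict_mono_on_def intro!: diff_less_mono)
    moreover have "r i - m < n" if "i < k" for i
      using r(2) that rm[OF that] by fastforce
    ultimately have "matrix_contains n B k \<pi>"
      unfolding matrix_contains_def using B c(1) cm
      by (intro exI[of _ "\<lambda>i. r i - m"] exI[of _ c]) auto
    then show ?thesis ..
  qed
qed

lemma ones_ge_sum:
  assumes "inj_on f X" "inj_on g Y" "f ` X \<subseteq> Z" "g ` Y \<subseteq> Z" "f ` X \<inter> g ` Y = {}" "finite Z"
  shows "card X + card Y \<le> card Z"
proof -
  have "finite (f ` X)" "finite (g ` Y)"
    using finite_subset[OF assms(3,6)] finite_subset[OF assms(4,6)] .
  then have "card X + card Y = card (f ` X \<union> g ` Y)"
    using card_Un_disjoint[OF _ _ assms(5)] card_image[OF assms(1)] card_image[OF assms(2)] by simp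
  also have "\<dots> \<le> card Z"
    using assms(3,4,6) by (intro card_mono) auto
  finally show ?thesis .
qed

text \<open>
  A permutation cannot be both a direct sum and a skew sum: its first and last entry decide
  whether the diagonal or the antidiagonal arrangement of two avoiding blocks avoids it.
\<close>

lemma ex_perm_superadditive:
  assumes "\<pi> permutes {..<k}" and "k > 0"
  shows "ex_perm k \<pi> m + ex_perm k \<pi> n \<le> ex_perm k \<pi> (m + n)"
proof -
  obtain A where A: "\<not> matrix_contains m A k \<pi>" "ex_perm k \<pi> m = ones m A"
    using ex_perm_attained[OF assms] .
  obtain B where B: "\<not> matrix_contains n B k \<pi>" "ex_perm k \<pi> n = ones n B"
    using ex_perm_attained[OF assms] .
  show ?thesis
  proof (cases "\<pi> 0 < \<pi> (k - 1)")
    case True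
    define M where "M = (\<lambda>i j. (i < m \<and> n \<le> j \<and> j < m + n \<and> A i (j - n)) \<or> (m \<le> i \<and> j < n \<and> B (i - m) j))"
    have "\<not> matrix_contains (m + n) M k \<pi>"
      using block_antidiagonal_contains[OF _ assms(2,1) _ True, of m n M A B] A B
      by (auto simp: M_def)
    moreover have "ones m A + ones n B \<le> ones (m + n) M"
      unfolding ones_def
      by (rule ones_ge_sum[of "\<lambda>(i, j). (i, j + n)" _ "\<lambda>(i, j). (i + m, j)"])
        (auto simp: inj_on_def M_def intro: finite_ones)
    ultimately show ?thesis
      using A B ones_le_ex_perm by fastforce
  next
    case False
    define M where "M = (\<lambda>i j. (i < m \<and> j < m \<and> A i j) \<or> (m \<le> i \<and> m \<le> j \<and> B (i - m) (j - m)))"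
    have "\<not> matrix_contains (m + n) M k \<pi>"
      using block_diagonal_contains[OF _ assms(2,1), of m n M A B] A B False
      by (auto simp: M_def)
    moreover have "ones m A + ones n B \<le> ones (m + n) M"
      unfolding ones_def
      by (rule ones_ge_sum[of id _ "\<lambda>(i, j). (i + m, j + m)"])
        (auto simp: inj_on_def M_def intro: finite_ones)
    ultimately show ?thesis
      using A B ones_le_ex_perm by fastforce
  qed
qed

lemma ex_perm_ge:
  assumes "\<pi> permutes {..<k}" and "k \<ge> 2" and "n > 0"
  shows "n \<le> ex_perm k \<pi> n"
proof -
  define A where "A = (\<lambda>i j::nat. i = (0::nat))"
  have "\<not> matrix_contains n A k \<pi>"
  proof
    assume "matrix_contains n A k \<pi>"
    then obtain r c where r: "strict_mono_on {..<k} r"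
      and "\<forall>i<k. \<forall>j<k. j = \<pi> i \<longrightarrow> A (r i) (c j)"
      unfolding matrix_contains_def by blast
    then have "r i = 0" if "i < k" for i
      using permutes_in_image[OF assms(1)] that by (simp add: A_def)
    moreover have "r 0 < r 1" using strict_mono_onD[OF r, of 0 1] assms(2) by auto
    ultimately show False using assms(2) by fastforce
  qed
  moreover have "ones n A = n"
  proof -
    have "{(i, j). i < n \<and> j < n \<and> A i j} = {0} \<times> {..<n}"
      using assms(3) by (auto simp: A_def)
    then show ?thesis by (simp add: ones_def)
  qed
  ultimately show ?thesis using ones_le_ex_perm by fastforce
qed

lemma superadditive_limit:
  fixes a :: "nat \<Rightarrow> nat" and C :: real
  assumes super: "\<And>m n. a m + a n \<le> a (m + n)"
    and bound: "\<And>n. real (a n) \<le> C * real n"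
  obtains L where "(\<lambda>n. real (a n) / real n) \<longlonglongrightarrow> L" "\<And>n. real (a n) \<le> L * real n"
proof -
  define L where "L = (SUP n. real (a n) / real n)"
  have C0: "C \<ge> 0" using bound[of 1] by simp
  have "real (a n) / real n \<le> C" for n
    using bound[of n] C0 by (cases "n = 0") (auto simp: divide_simps)
  then have bdd: "bdd_above (range (\<lambda>n. real (a n) / real n))"
    by (auto intro!: bdd_aboveI)
  have le: "real (a n) / real n \<le> L" for n
    unfolding L_def by (rule cSUP_upper[OF _ bdd]) simp
  have mult: "q * a m \<le> a (q * m)" for q m
  proof (induction q)
    case (Suc q)
    then show ?case using super[of m "q * m"] by simp
  qed simp
  have "(\<lambda>n. real (a n) / real n) \<longlonglongrightarrow> L"
  proof (rule LIMSEQ_I)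
    fix e :: real assume "e > 0"
    then have "\<exists>m. L - e / 2 < real (a m) / real m"
      using less_cSUP_iff[OF _ bdd, of "L - e / 2"] by (auto simp: L_def)
    then obtain m where m: "L - e / 2 < real (a m) / real m" by blast
    have L0: "L \<ge> 0" using le[of 0] by simp
    obtain N0 where "2 * real (m * m + m) * (L + 1) / e < real N0"
      using reals_Archimedean2 by blast
    then obtain N where N: "real N > 2 * real (m * m + m) * (L + 1) / e" "N > 0"
      using that[of "Suc N0"] by simp
    have "norm (real (a n) / real n - L) < e" if "n \<ge> N" for n
    proof (cases "m = 0")
      case True
      then have "L < e" using m \<open>e > 0\<close> by simp
      then show ?thesis using le[of n] L0 by (simp add: abs_if) (smt (verit) divide_nonneg_nonneg of_nat_0_le_iff)
    next
      case False
      define q where "q = n div m"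
      have n0: "n > 0" using that N(2) by simp
      have qm: "q * m \<le> n" "real n \<le> real q * real m + real m"
      proof -
        show "q * m \<le> n" by (simp add: q_def)
        have "n \<le> q * m + m"
          using mod_less_divisor[of m n] False div_mult_mod_eq[of n m] unfolding q_def by linarith
        then show "real n \<le> real q * real m + real m"
          by (metis of_nat_add of_nat_le_iff of_nat_mult)
      qed
      have "q * a m \<le> a n"
        using mult[of q m] super[of "q * m" "n - q * m"] qm(1) by simp
      then have "real q * real (a m) \<le> real (a n)"
        by (metis of_nat_le_iff of_nat_mult)
      moreover have "(L - e / 2) * real m \<le> real (a m)"
        using m False by (simp add: field_simps)
      then have "real q * ((L - e / 2) * real m) \<le> real q * real (a m)"
        by (simp add: mult_left_mono)
      ultimately have 1: "(L - e / 2) * (real q * real m) \<le> real (a n)"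
        by (simp add: algebra_simps)
      have 2: "real m * L < e / 2 * real n"
      proof -
        have "2 * real (m * m + m) * (L + 1) < e * real N"
          using N(1) \<open>e > 0\<close> by (simp add: field_simps)
        also have "\<dots> \<le> e * real n" using that \<open>e > 0\<close> by simp
        finally have "2 * real (m * m + m) * (L + 1) < e * real n" .
        moreover have "real m * L \<le> real (m * m + m) * (L + 1)"
          using L0 by (intro mult_mono) auto
        ultimately have "2 * (real m * L) < e * real n" by (simp only: mult.assoc)
        then show ?thesis by simp
      qed
      have 3: "real n * L - real m * L \<le> real q * real m * L"
        using mult_right_mono[OF qm(2) L0] by (simp add: algebra_simps)
      have 4: "e / 2 * (real q * real m) \<le> e / 2 * real n"
      proof -
        have "real q * real m \<le> real n" using qm(1) by (metis of_nat_le_iff of_nat_mult)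
        then show ?thesis using \<open>e > 0\<close> by simp
      qed
      have "real n * L - e * real n < real (a n)"
        using 1 2 3 4 by (simp add: algebra_simps)
      then have "L - e < real (a n) / real n"
        using n0 by (simp add: field_simps)
      then show ?thesis using le[of n] by simp
    qed
    then show "\<exists>N. \<forall>n\<ge>N. norm (real (a n) / real n - L) < e" by blast
  qed
  moreover have "real (a n) \<le> L * real n" for n
    using le[of n] bound[of 0] by (cases "n = 0") (auto simp: divide_simps)
  ultimately show ?thesis using that by blast
qed


subsection \<open>The Marcus-Tardos theorem\<close>

lemma card_le_fibres:
  assumes "finite Y" and "f ` X \<subseteq> Y" and "\<And>y. y \<in> Y \<Longrightarrow> card {x \<in> X. f x = y} \<le> b"
  shows "card X \<le> card Y * b"
proof -
  have "X = (\<Union>y\<in>Y. {x \<in> X. f x = y})" using assms(2) by auto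
  then have "card X \<le> (\<Sum>y\<in>Y. card {x \<in> X. f x = y})"
    using card_UN_le[OF assms(1), of "\<lambda>y. {x \<in> X. f x = y}"] by simp
  also have "\<dots> \<le> (\<Sum>y\<in>Y. b)" by (intro sum_mono assms(3))
  finally show ?thesis by simp
qed

lemma card_UN_le_mult:
  assumes "finite X" and "card X \<le> m" and "\<And>x. x \<in> X \<Longrightarrow> card (f x) \<le> b"
  shows "card (\<Union>x\<in>X. f x) \<le> m * b"
proof -
  have "card (\<Union>x\<in>X. f x) \<le> (\<Sum>x\<in>X. card (f x))" by (rule card_UN_le[OF assms(1)])
  also have "\<dots> \<le> (\<Sum>x\<in>X. b)" by (intro sum_mono assms(3))
  also have "\<dots> \<le> m * b" using assms(2) by simp
  finally show ?thesis .
qed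

lemma strict_mono_enumeration:
  fixes X :: "nat set"
  assumes "finite X" and "k \<le> card X"
  obtains h where "strict_mono_on {..<k} h" and "h ` {..<k} \<subseteq> X"
proof -
  obtain h where h: "bij_betw h {..<card X} X" "strict_mono_on {..<card X} h"
    using ex_bij_betw_strict_mono_card[OF assms(1)] .
  have "{..<k} \<subseteq> {..<card X}" using assms(2) by auto
  then have "strict_mono_on {..<k} h" and "h ` {..<k} \<subseteq> X"
    using h by (auto simp: strict_mono_on_def bij_betw_def)
  then show ?thesis using that by blast
qed

lemma div_eq_atLeastLessThan:
  assumes "S > 0"
  shows "{j. j div S = J} = {J * S..<J * S + (S::nat)}"
proof safe
  fix j
  show "j \<in> {j div S * S..<j div S * S + S}"
    using div_mult_mod_eq[of j S] mod_less_divisor[OF assms, of j]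
    unfolding atLeastLessThan_iff by linarith
next
  fix j assume "j \<in> {J * S..<J * S + S}"
  then show "j div S = J" by (intro div_nat_eqI) (auto simp: mult.commute)
qed

lemma div_less_imp_less: "(i::nat) div S < j div S \<Longrightarrow> i < j"
  by (meson div_le_mono leD leI)

lemma strict_mono_on_div:
  assumes "strict_mono_on {..<k} e" and "\<And>i. i < k \<Longrightarrow> r i div S = (e i :: nat)"
  shows "strict_mono_on {..<k::nat} r"
proof (rule strict_mono_onI)
  fix i j assume "i \<in> {..<k}" "j \<in> {..<k}" "i < j"
  then have "r i div S < r j div S"
    using strict_mono_onD[OF assms(1)] assms(2) by simp
  then show "r i < r j" by (rule div_less_imp_less)
qed

text \<open>
  Pigeonhole on the set of non-zero columns: \<open>k\<close> blocks of a block column that share \<open>k\<close> non-zero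
  columns contain every permutation matrix of size \<open>k\<close>.
\<close>

lemma card_wide_blocks:
  assumes "\<pi> permutes {..<k}" and "S > 0" and "\<not> matrix_contains (S * N) A k \<pi>" and "J < N"
  shows "card {I. I < N \<and> k \<le> card {j. j div S = J \<and> (\<exists>i. i div S = I \<and> A i j)}} \<le> 2 ^ S * k"
proof -
  define cols where "cols I = {j. j div S = J \<and> (\<exists>i. i div S = I \<and> A i j)}" for I
  define W where "W = {I. I < N \<and> k \<le> card (cols I)}"
  have block: "finite {j. j div S = J}" "card {j. j div S = J} = S"
    using assms(2) by (simp_all add: div_eq_atLeastLessThan)
  have fibre: "card {I \<in> W. cols I = C} \<le> k" for C
  proof (rule ccontr)
    assume "\<not> card {I \<in> W. cols I = C} \<le> k"
    then have *: "k \<le> card {I \<in> W. cols I = C}" "{I \<in> W. cols I = C} \<noteq> {}"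
      by (simp, metis card.empty le0)
    then have C: "C \<subseteq> {j. j div S = J}" "k \<le> card C"
      by (auto simp: W_def cols_def)
    have "finite {I \<in> W. cols I = C}" by (simp add: W_def)
    from strict_mono_enumeration[OF this *(1)] obtain e
      where e: "strict_mono_on {..<k} e" "e ` {..<k} \<subseteq> {I \<in> W. cols I = C}" .
    obtain c where c: "strict_mono_on {..<k} c" "c ` {..<k} \<subseteq> C"
      using strict_mono_enumeration[OF finite_subset[OF C(1) block(1)] C(2)] .
    have "\<exists>r. r div S = e i \<and> A r (c (\<pi> i))" if "i < k" for i
    proof -
      have "\<pi> i < k" using permutes_in_image[OF assms(1)] that by simp
      then have "c (\<pi> i) \<in> cols (e i)" using c(2) e(2) that by blast
      then show ?thesis by (auto simp: cols_def)
    qed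
    then obtain r where r: "\<And>i. i < k \<Longrightarrow> r i div S = e i \<and> A (r i) (c (\<pi> i))"
      by metis
    have less: "x < S * N" if "x div S < N" for x
      using that assms(2) by (simp add: div_less_iff_less_mult mult.commute)
    have "strict_mono_on {..<k} r"
      using strict_mono_on_div[OF e(1)] r by blast
    moreover have "r ` {..<k} \<subseteq> {..<S * N}"
      using e(2) r by (auto simp: W_def intro!: less)
    moreover have "c ` {..<k} \<subseteq> {..<S * N}"
      using c(2) C(1) assms(4) by (auto intro!: less)
    ultimately have "matrix_contains (S * N) A k \<pi>"
      unfolding matrix_contains_def using c(1) r by blast
    with assms(3) show False ..
  qed
  have "card W \<le> card (Pow {j. j div S = J}) * k"
    using block(1) fibre by (intro card_le_fibres[of _ cols]) (auto simp: cols_def)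
  then show ?thesis
    using block by (simp add: card_Pow W_def cols_def)
qed

lemma ex_perm_block_recursion:
  assumes \<pi>: "\<pi> permutes {..<k}" and "k > 0" and "S > 0"
  shows "ex_perm k \<pi> (S * N) \<le> 2 * (N * ((2 ^ S * k) * (S * S))) + ex_perm k \<pi> N * ((k - 1) * (k - 1))"
proof -
  obtain A where A: "\<not> matrix_contains (S * N) A k \<pi>" "ex_perm k \<pi> (S * N) = ones (S * N) A"
    using ex_perm_attained[OF \<pi> \<open>k > 0\<close>] .
  define blk where "blk I J = {(i, j). i div S = I \<and> j div S = J \<and> A i j}" for I J
  define cols where "cols I J = {j. j div S = J \<and> (\<exists>i. i div S = I \<and> A i j)}" for I J
  define rows where "rows I J = {i. i div S = I \<and> (\<exists>j. j div S = J \<and> A i j)}" for I J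
  define B where "B I J \<longleftrightarrow> blk I J \<noteq> {}" for I J
  define W where "W J = {I. I < N \<and> k \<le> card (cols I J)}" for J
  define T where "T I = {J. J < N \<and> k \<le> card (rows I J)}" for I
  define R where "R = {(I, J). I < N \<and> J < N \<and> B I J \<and> card (cols I J) < k \<and> card (rows I J) < k}"
  have fin: "finite (cols I J)" "finite (rows I J)"
    and S: "card (cols I J) \<le> S" "card (rows I J) \<le> S" for I J
  proof -
    have "cols I J \<subseteq> {j. j div S = J}" "rows I J \<subseteq> {i. i div S = I}"
      by (auto simp: cols_def rows_def)
    then have "cols I J \<subseteq> {J * S..<J * S + S}" "rows I J \<subseteq> {I * S..<I * S + S}"
      using div_eq_atLeastLessThan[OF \<open>S > 0\<close>] by blast+
    then show "finite (cols I J)" "finite (rows I J)" "card (cols I J) \<le> S" "card (rows I J) \<le> S"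
      using card_mono[of "{J * S..<J * S + S}" "cols I J"] card_mono[of "{I * S..<I * S + S}" "rows I J"]
        finite_subset by auto
  qed
  have blk: "blk I J \<subseteq> rows I J \<times> cols I J" for I J
    by (auto simp: blk_def rows_def cols_def)
  have card_blk: "card (blk I J) \<le> card (rows I J) * card (cols I J)" for I J
    using card_mono[OF _ blk] fin by (simp add: card_cartesian_product)
  have avoid_B: "\<not> matrix_contains N B k \<pi>"
  proof
    assume "matrix_contains N B k \<pi>"
    then obtain r c where rc: "strict_mono_on {..<k} r" "r ` {..<k} \<subseteq> {..<N}"
      "strict_mono_on {..<k} c" "c ` {..<k} \<subseteq> {..<N}"
      and "\<forall>i<k. \<forall>j<k. j = \<pi> i \<longrightarrow> B (r i) (c j)"
      unfolding matrix_contains_def by blast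
    then have "B (r i) (c (\<pi> i))" if "i < k" for i
      using permutes_in_image[OF \<pi>] that by simp
    then have "\<exists>x y. x div S = r i \<and> y div S = c (\<pi> i) \<and> A x y" if "i < k" for i
      using that by (fastforce simp: B_def blk_def)
    then obtain x y where xy:
      "\<And>i. i < k \<Longrightarrow> x i div S = r i \<and> y i div S = c (\<pi> i) \<and> A (x i) (y i)"
      by metis
    define y' where "y' j = y (inv \<pi> j)" for j
    have inv: "inv \<pi> j < k" "\<pi> (inv \<pi> j) = j" if "j < k" for j
      using permutes_in_image[OF permutes_inv[OF \<pi>]] permutes_inverses(1)[OF \<pi>] that by auto
    have y': "y' j div S = c j" if "j < k" for j
      using xy[OF inv(1)[OF that]] inv(2)[OF that] by (simp add: y'_def)
    have less: "x < S * N" if "x div S < N" for x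
      using that \<open>S > 0\<close> by (simp add: div_less_iff_less_mult mult.commute)
    have "strict_mono_on {..<k} x" "strict_mono_on {..<k} y'"
      using strict_mono_on_div[OF rc(1)] strict_mono_on_div[OF rc(3)] xy y' by blast+
    moreover have "x ` {..<k} \<subseteq> {..<S * N}" "y' ` {..<k} \<subseteq> {..<S * N}"
      using rc(2,4) xy y' by (auto intro!: less)
    moreover have "A (x i) (y' (\<pi> i))" if "i < k" for i
      using xy[OF that] permutes_inverses(2)[OF \<pi>] by (simp add: y'_def)
    ultimately have "matrix_contains (S * N) A k \<pi>"
      unfolding matrix_contains_def by blast
    with A(1) show False ..
  qed
  have W: "card (W J) \<le> 2 ^ S * k" if "J < N" for J
    using card_wide_blocks[OF \<pi> \<open>S > 0\<close> A(1) that] by (simp add: W_def cols_def)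
  have T: "card (T I) \<le> 2 ^ S * k" if "I < N" for I
  proof -
    have "\<not> matrix_contains (S * N) (\<lambda>i j. A j i) k (inv \<pi>)"
      using matrix_contains_transpose[OF \<pi>] A(1) by blast
    from card_wide_blocks[OF permutes_inv[OF \<pi>] \<open>S > 0\<close> this that]
    show ?thesis by (simp add: T_def rows_def)
  qed
  have "card R \<le> ones N B"
    unfolding ones_def by (rule card_mono[OF finite_ones]) (auto simp: R_def)
  then have R: "card R \<le> ex_perm k \<pi> N"
    using ones_le_ex_perm[OF avoid_B] by simp
  have finR: "finite R"
    by (rule finite_subset[of _ "{..<N} \<times> {..<N}"]) (auto simp: R_def)
  define U1 where "U1 = (\<Union>J\<in>{..<N}. \<Union>I\<in>W J. blk I J)"
  define U2 where "U2 = (\<Union>I\<in>{..<N}. \<Union>J\<in>T I. blk I J)"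
  define U3 where "U3 = (\<Union>(I, J)\<in>R. blk I J)"
  have SS: "card (blk I J) \<le> S * S" for I J
    using card_blk[of I J] mult_mono[OF S(2)[of I J] S(1)[of I J]] by simp
  have U1: "card U1 \<le> N * ((2 ^ S * k) * (S * S))"
    unfolding U1_def by (intro card_UN_le_mult W SS) (auto simp: W_def)
  have U2: "card U2 \<le> N * ((2 ^ S * k) * (S * S))"
    unfolding U2_def by (intro card_UN_le_mult T SS) (auto simp: T_def)
  have "card (blk I J) \<le> (k - 1) * (k - 1)" if "(I, J) \<in> R" for I J
  proof -
    have "card (rows I J) \<le> k - 1" "card (cols I J) \<le> k - 1"
      using that by (auto simp: R_def)
    then show ?thesis
      using order_trans[OF card_blk mult_mono] by blast
  qed
  then have U3: "card U3 \<le> ex_perm k \<pi> N * ((k - 1) * (k - 1))"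
    unfolding U3_def by (intro card_UN_le_mult R finR) auto
  have fin_blk: "finite (blk I J)" for I J
    using blk finite_subset fin by (metis finite_cartesian_product)
  have fin_U: "finite (U1 \<union> U2 \<union> U3)"
    using finR by (auto simp: U1_def U2_def U3_def W_def T_def intro!: fin_blk)
  have sub: "{(i, j). i < S * N \<and> j < S * N \<and> A i j} \<subseteq> U1 \<union> U2 \<union> U3"
  proof safe
    fix i j assume ij: "i < S * N" "j < S * N" "A i j" "(i, j) \<notin> U3" "(i, j) \<notin> U2"
    then have mem: "(i, j) \<in> blk (i div S) (j div S)" by (simp add: blk_def)
    have N: "i div S < N" "j div S < N"
      using ij(1,2) by (simp_all add: less_mult_imp_div_less mult.commute)
    have "k \<le> card (cols (i div S) (j div S))"
    proof (rule ccontr)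
      assume "\<not> k \<le> card (cols (i div S) (j div S))"
      moreover have "\<not> k \<le> card (rows (i div S) (j div S))"
        using ij(5) mem N by (auto simp: U2_def T_def)
      ultimately have "(i div S, j div S) \<in> R"
        using N mem by (auto simp: R_def B_def)
      then show False using ij(4) mem by (auto simp: U3_def)
    qed
    then show "(i, j) \<in> U1"
      using mem N by (auto simp: U1_def W_def)
  qed
  have "ones (S * N) A \<le> card (U1 \<union> U2 \<union> U3)"
    unfolding ones_def by (rule card_mono[OF fin_U sub])
  also have "\<dots> \<le> card U1 + card U2 + card U3"
    using card_Un_le[of "U1 \<union> U2" U3] card_Un_le[of U1 U2] by simp
  finally show ?thesis using U1 U2 U3 A(2) by simp
qed

theorem marcus_tardos:
  assumes \<pi>: "\<pi> permutes {..<k}" and "k \<ge> 2"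
  obtains C where "\<And>n. ex_perm k \<pi> n \<le> C * n"
proof -
  define S where "S = k * k"
  define D where "D = 2 * ((2 ^ S * k) * (S * S)) + 1"
  have "k > 0" "S > 0" using assms(2) by (simp_all add: S_def)
  have "(k - 1) * (k - 1) + 1 \<le> S"
    using assms(2) by (cases k) (auto simp: S_def)
  have pow: "ex_perm k \<pi> (S ^ j) \<le> D * S ^ j" for j
  proof (induction j)
    case 0
    obtain A where "ex_perm k \<pi> 1 = ones 1 A" using ex_perm_attained[OF \<pi> \<open>k > 0\<close>] .
    then show ?case using ones_le_square[of 1 A] by (simp add: D_def)
  next
    case (Suc j)
    have "ex_perm k \<pi> (S * S ^ j) \<le> D * S ^ j + D * S ^ j * ((k - 1) * (k - 1))"
    proof (rule order_trans[OF ex_perm_block_recursion[OF \<pi> \<open>k > 0\<close> \<open>S > 0\<close>]], rule add_mono)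
      show "2 * (S ^ j * (2 ^ S * k * (S * S))) \<le> D * S ^ j"
        by (simp add: D_def algebra_simps)
      show "ex_perm k \<pi> (S ^ j) * ((k - 1) * (k - 1)) \<le> D * S ^ j * ((k - 1) * (k - 1))"
        by (rule mult_right_mono[OF Suc]) simp
    qed
    also have "\<dots> = D * S ^ j * ((k - 1) * (k - 1) + 1)"
      by (simp add: algebra_simps)
    also have "\<dots> \<le> D * S ^ j * S"
      by (rule mult_left_mono[OF \<open>(k - 1) * (k - 1) + 1 \<le> S\<close>]) simp
    finally show ?case by (simp add: mult.commute mult.left_commute)
  qed
  have "ex_perm k \<pi> n \<le> (D * S) * n" for n
  proof (cases "n = 0")
    case True
    obtain A where "ex_perm k \<pi> 0 = ones 0 A" using ex_perm_attained[OF \<pi> \<open>k > 0\<close>] .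
    then show ?thesis using True by (simp add: ones_def)
  next
    case False
    have "S > 1" using mult_le_mono[OF assms(2) assms(2)] by (simp add: S_def)
    have "\<exists>j. n \<le> S ^ j"
      using power_gt_expt[of S] \<open>S > 1\<close> by (metis One_nat_def less_imp_le)
    define j where "j = (LEAST j. n \<le> S ^ j)"
    have j: "n \<le> S ^ j" unfolding j_def by (rule LeastI_ex) fact
    have "S ^ j \<le> S * n"
    proof (cases j)
      case 0
      then show ?thesis using False \<open>S > 0\<close> by simp
    next
      case (Suc i)
      then have "S ^ i < n"
        using not_less_Least[of i "\<lambda>j. n \<le> S ^ j"] by (simp add: j_def)
      then show ?thesis using Suc by simp
    qed
    have "ex_perm k \<pi> n \<le> ex_perm k \<pi> (S ^ j)"
      using ex_perm_superadditive[OF \<pi> \<open>k > 0\<close>, of n "S ^ j - n"] j by simp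
    also have "\<dots> \<le> D * S ^ j" by (rule pow)
    also have "\<dots> \<le> D * (S * n)" using \<open>S ^ j \<le> S * n\<close> by (rule mult_left_mono) simp
    finally show ?thesis by (simp add: mult.assoc)
  qed
  then show ?thesis using that by blast
qed

lemma ex_perm_le_fh_limit:
  assumes "\<pi> permutes {..<k}" and "k \<ge> 2"
  shows "real (ex_perm k \<pi> n) \<le> fh_limit k \<pi> * real n"
proof -
  obtain C where "\<And>n. ex_perm k \<pi> n \<le> C * n" using marcus_tardos[OF assms] by blast
  then have "real (ex_perm k \<pi> n) \<le> real C * real n" for n
    by (metis of_nat_le_iff of_nat_mult)
  moreover have "ex_perm k \<pi> m + ex_perm k \<pi> n \<le> ex_perm k \<pi> (m + n)" for m n
    using ex_perm_superadditive[OF assms(1)] assms(2) by simp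
  ultimately obtain L where "(\<lambda>n. real (ex_perm k \<pi> n) / real n) \<longlonglongrightarrow> L"
    "\<And>n. real (ex_perm k \<pi> n) \<le> L * real n"
    using superadditive_limit[of "ex_perm k \<pi>" "real C"] by blast
  then show ?thesis by (simp add: fh_limit_def limI)
qed

lemma fh_limit_ge_1:
  assumes "\<pi> permutes {..<k}" and "k \<ge> 2"
  shows "fh_limit k \<pi> \<ge> 1"
  using ex_perm_le_fh_limit[OF assms, of 1] ex_perm_ge[OF assms, of 1] by simp


subsection \<open>Pattern avoidance and griddings\<close>

text \<open>
  Interpreting the locale on a proper subset of a type yields its constants in locale form; the
  next lemma identifies them with the class constants.
\<close>

lemma insort_key_class_eq:
  fixes f :: "'b \<Rightarrow> 'a::linorder"
  shows "linorder.insort_key (\<le>) f x xs = insort_key f x xs"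
  by (induction xs) (simp_all add: linorder.insort_key.simps[OF linorder_class.linorder_axioms])

lemma order_embedding_imp_not_avoids:
  fixes z :: "nat \<Rightarrow> point"
  assumes "finite P" and "general_position P"
    and z: "\<And>i. i < k \<Longrightarrow> z i \<in> P"
    and fst_z: "\<And>i j. i < j \<Longrightarrow> j < k \<Longrightarrow> fst (z i) < fst (z j)"
    and snd_z: "\<And>i j. i < k \<Longrightarrow> j < k \<Longrightarrow> snd (z i) < snd (z j) \<longleftrightarrow> \<pi> i < \<pi> j"
  shows "\<not> avoids P k \<pi>"
proof -
  have inj: "inj_on fst P" using assms(2) by (simp add: general_position_def)
  interpret folding_insort_key "(\<le>)" "(<)" P "fst :: point \<Rightarrow> real"
    rewrites "linorder.sorted_key_list_of_set (\<le>) (fst :: point \<Rightarrow> real) = sorted_key_list_of_set fst"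
  proof -
    have "linorder.insort_key (\<le>) (fst :: point \<Rightarrow> real) = insort_key fst"
      by (intro ext insort_key_class_eq)
    then show "linorder.sorted_key_list_of_set (\<le>) (fst :: point \<Rightarrow> real) = sorted_key_list_of_set fst"
      by (simp add: sorted_key_list_of_set_def
          linorder.sorted_key_list_of_set_def[OF linorder_class.linorder_axioms])
  qed (unfold_locales, rule inj)
  define xs where "xs = sorted_key_list_of_set fst P"
  have xs: "set xs = P" "sorted (map fst xs)" "distinct (map fst xs)"
    using set_sorted_key_list_of_set[OF subset_refl \<open>finite P\<close>]
      sorted_sorted_key_list_of_set[OF subset_refl] distinct_sorted_key_list_of_set[OF subset_refl]
    by (auto simp: xs_def)
  define ys where "ys = filter (\<lambda>p. p \<in> z ` {..<k}) xs"
  have strict: "sorted_wrt (<) (map fst (map z [0..<k]))"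
    using fst_z by (auto simp: sorted_wrt_iff_nth_less)
  have "ys = map z [0..<k]"
  proof (rule map_sorted_distinct_set_unique[of fst])
    show "set ys = set (map z [0..<k])"
      using xs(1) z by (auto simp: ys_def)
    show "inj_on fst (set ys \<union> set (map z [0..<k]))"
      by (rule inj_on_subset[OF inj]) (use xs(1) z in \<open>auto simp: ys_def\<close>)
    show "sorted (map fst ys)" "distinct (map fst ys)"
      using xs by (auto simp: ys_def sorted_filter distinct_map_filter)
    show "sorted (map fst (map z [0..<k]))" "distinct (map fst (map z [0..<k]))"
      using strict by (simp_all only: strict_sorted_iff)
  qed
  define rank where "rank = (\<lambda>p::point. card {q \<in> P. snd q < snd p})"
  have "subseq ys xs" by (simp add: ys_def)
  then have "subseq (map rank (map z [0..<k])) (perm_of_points P)"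
    unfolding perm_of_points_def xs_def[symmetric] rank_def[symmetric] \<open>ys = map z [0..<k]\<close>
    by (rule subseq_map)
  moreover have "order_isomorphic (map rank (map z [0..<k])) (map \<pi> [0..<k])"
  proof -
    have mono: "rank p \<le> rank q" if "snd p \<le> snd q" for p q
      unfolding rank_def using \<open>finite P\<close> that by (intro card_mono) auto
    have strict_mono: "rank p < rank q" if "snd p < snd q" "p \<in> P" for p q
      unfolding rank_def using \<open>finite P\<close> that by (intro psubset_card_mono) auto
    have "rank (z i) < rank (z j) \<longleftrightarrow> snd (z i) < snd (z j)" if "i < k" "j < k" for i j
      using mono[of "z j" "z i"] strict_mono[of "z i" "z j"] z[OF that(1)] by fastforce
    then show ?thesis
      using snd_z by (simp add: order_isomorphic_def)
  qed
  ultimately show ?thesis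
    unfolding avoids_def by blast
qed

lemma unit_partition_nth_less:
  assumes "unit_partition Is" and "i < j" and "j < length Is" and "x \<in> Is ! i" and "y \<in> Is ! j"
  shows "x < y"
  using assms sorted_wrt_nth_less[of _ Is i j] unfolding unit_partition_def by blast

lemma unit_partition_unique:
  assumes "unit_partition Is" and "I \<in> set Is" and "J \<in> set Is" and "x \<in> I" and "x \<in> J"
  shows "I = J"
proof -
  obtain i j where ij: "i < length Is" "j < length Is" "I = Is ! i" "J = Is ! j"
    using assms(2,3) by (metis in_set_conv_nth)
  then have "i = j"
    using unit_partition_nth_less[OF assms(1), of i j x x] unit_partition_nth_less[OF assms(1), of j i x x]
      assms(4,5) by (cases i j rule: linorder_cases) auto
  then show ?thesis using ij by simp
qed

lemma card_nonempty_cells: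
  assumes Is: "unit_partition Is" and Js: "unit_partition Js"
    and "finite P" and "general_position P" and \<pi>: "\<pi> permutes {..<k}" and "avoids P k \<pi>"
  shows "card {(I, J) \<in> set Is \<times> set Js. (I \<times> J) \<inter> P \<noteq> {}} \<le> ex_perm k \<pi> (max (length Is) (length Js))"
proof -
  define A where "A i j \<longleftrightarrow> i < length Is \<and> j < length Js \<and> (Is ! i \<times> Js ! j) \<inter> P \<noteq> {}" for i j
  let ?n = "max (length Is) (length Js)"
  have "\<not> matrix_contains ?n A k \<pi>"
  proof
    assume "matrix_contains ?n A k \<pi>"
    then obtain r c where r: "strict_mono_on {..<k} r" and c: "strict_mono_on {..<k} c"
      and "\<forall>i<k. \<forall>j<k. j = \<pi> i \<longrightarrow> A (r i) (c j)"
      unfolding matrix_contains_def by blast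
    moreover have pk: "\<pi> i < k" if "i < k" for i
      using permutes_in_image[OF \<pi>] that by simp
    ultimately have A: "A (r i) (c (\<pi> i))" if "i < k" for i
      using that by blast
    then have "\<forall>i. i < k \<longrightarrow> (\<exists>p. p \<in> (Is ! r i \<times> Js ! c (\<pi> i)) \<inter> P)"
      unfolding A_def by blast
    then obtain z where z: "\<And>i. i < k \<Longrightarrow> z i \<in> (Is ! r i \<times> Js ! c (\<pi> i)) \<inter> P"
      by metis
    have fst_z: "fst (z i) < fst (z j)" if "i < j" "j < k" for i j
      using unit_partition_nth_less[OF Is, of "r i" "r j"] strict_mono_onD[OF r, of i j] that
        z[of i] z[of j] A[of j] by (auto simp: A_def mem_Times_iff)
    have snd_less: "snd (z i) < snd (z j)" if "\<pi> i < \<pi> j" "i < k" "j < k" for i j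
      using unit_partition_nth_less[OF Js, of "c (\<pi> i)" "c (\<pi> j)"]
        strict_mono_onD[OF c, of "\<pi> i" "\<pi> j"] that pk z[of i] z[of j] A[of j]
      by (auto simp: A_def mem_Times_iff)
    have "snd (z i) < snd (z j) \<longleftrightarrow> \<pi> i < \<pi> j" if "i < k" "j < k" for i j
      using snd_less[of i j] snd_less[of j i] that permutes_inj[OF \<pi>]
      by (metis injD less_asym linorder_cases)
    then have "\<not> avoids P k \<pi>"
      using order_embedding_imp_not_avoids[of P k z \<pi>] assms(3,4) z fst_z by blast
    with assms(6) show False by simp
  qed
  then have "ones ?n A \<le> ex_perm k \<pi> ?n" by (rule ones_le_ex_perm)
  moreover have "card {(I, J) \<in> set Is \<times> set Js. (I \<times> J) \<inter> P \<noteq> {}} \<le> ones ?n A"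
  proof -
    have "{(I, J) \<in> set Is \<times> set Js. (I \<times> J) \<inter> P \<noteq> {}}
        \<subseteq> (\<lambda>(i, j). (Is ! i, Js ! j)) ` {(i, j). i < ?n \<and> j < ?n \<and> A i j}"
    proof clarify
      fix I J assume IJ: "I \<in> set Is" "J \<in> set Js" "(I \<times> J) \<inter> P \<noteq> {}"
      then obtain i j where "i < length Is" "j < length Js" "I = Is ! i" "J = Js ! j"
        by (metis in_set_conv_nth)
      then show "(I, J) \<in> (\<lambda>(i, j). (Is ! i, Js ! j)) ` {(i, j). i < ?n \<and> j < ?n \<and> A i j}"
        using IJ(3) by (intro image_eqI[of _ _ "(i, j)"]) (auto simp: A_def)
    qed
    then show ?thesis
      unfolding ones_def using finite_ones by (rule surj_card_le[rotated])
  qed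
  ultimately show ?thesis by simp
qed

subsection \<open>Partitions of the unit interval\<close>

lemma unit_partition_member:
  assumes "unit_partition Is" and "I \<in> set Is"
  shows "I \<noteq> {}" "I \<subseteq> {0..1}" "is_interval I" "bdd_above I" "bdd_below I"
proof -
  show "I \<noteq> {}" "is_interval I" "I \<subseteq> {0..1}"
    using assms unfolding unit_partition_def by auto
  then show "bdd_above I" "bdd_below I"
    using bdd_above_mono[of "{0..1}" I] bdd_below_mono[of "{0..1}" I] by simp_all
qed

lemma unit_partition_nonempty: "unit_partition Is \<Longrightarrow> length Is \<ge> 1"
  by (cases Is) (auto simp: unit_partition_def)

lemma extent_mono:
  assumes "A \<subseteq> B" and "A \<noteq> {}" and "bdd_above B" and "bdd_below B"
  shows "extent A \<le> extent B"
  using cSup_subset_mono[OF assms(2,3,1)] cInf_superset_mono[OF assms(2,4,1)]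
  by (simp add: extent_def)

lemma extent_nonneg: "A \<noteq> {} \<Longrightarrow> bdd_above A \<Longrightarrow> bdd_below A \<Longrightarrow> 0 \<le> extent A"
  by (simp add: extent_def cInf_le_cSup)

definition left_end :: "real set list \<Rightarrow> nat \<Rightarrow> real" where
  "left_end Is j = (if j < length Is then Inf (Is ! j) else 1)"

lemma left_end_bounds:
  assumes "unit_partition Is"
  shows "0 \<le> left_end Is j" "left_end Is j \<le> 1"
proof -
  have "0 \<le> Inf (Is ! j) \<and> Inf (Is ! j) \<le> 1" if "j < length Is"
  proof -
    note I = unit_partition_member[OF assms nth_mem[OF that]]
    obtain x where x: "x \<in> Is ! j" using I(1) by blast
    have "Inf (Is ! j) \<le> x" using x I(5) by (rule cInf_lower)
    moreover have "0 \<le> Inf (Is ! j)" using I(1,2) by (intro cInf_greatest) auto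
    ultimately show ?thesis using x I(2) by auto
  qed
  then show "0 \<le> left_end Is j" "left_end Is j \<le> 1" by (auto simp: left_end_def)
qed

lemma le_left_end:
  assumes "unit_partition Is" and "x \<in> Is ! i" and "i < j" and "i < length Is"
  shows "x \<le> left_end Is j"
proof (cases "j < length Is")
  case True
  have "x \<le> y" if "y \<in> Is ! j" for y
    using unit_partition_nth_less[OF assms(1,3) True assms(2) that] by simp
  then have "x \<le> Inf (Is ! j)"
    using unit_partition_member(1)[OF assms(1) nth_mem[OF True]] by (intro cInf_greatest)
  then show ?thesis using True by (simp add: left_end_def)
next
  case False
  then show ?thesis
    using unit_partition_member(2)[OF assms(1) nth_mem[OF assms(4)]] assms(2)
    by (auto simp: left_end_def)
qed

lemma extent_le_left_end_diff:
  assumes "unit_partition Is" and "j < length Is"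
  shows "extent (Is ! j) \<le> left_end Is (Suc j) - left_end Is j"
proof -
  have "Sup (Is ! j) \<le> left_end Is (Suc j)"
    using le_left_end[OF assms(1), of _ j "Suc j"] assms(2)
      unit_partition_member(1)[OF assms(1) nth_mem[OF assms(2)]]
    by (intro cSup_least) auto
  then show ?thesis using assms(2) by (simp add: extent_def left_end_def)
qed

lemma extent_union_le_left_end_diff:
  assumes "unit_partition Is" and "Suc j < length Is"
  shows "extent (Is ! j \<union> Is ! Suc j) \<le> left_end Is (Suc (Suc j)) - left_end Is j"
proof -
  have j: "j < length Is" using assms(2) by simp
  note I = unit_partition_member[OF assms(1) nth_mem[OF j]]
  note J = unit_partition_member[OF assms(1) nth_mem[OF assms(2)]]
  have "Sup (Is ! j \<union> Is ! Suc j) \<le> left_end Is (Suc (Suc j))"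
    using le_left_end[OF assms(1), of _ j "Suc (Suc j)"]
      le_left_end[OF assms(1), of _ "Suc j" "Suc (Suc j)"] assms(2) I(1)
    by (intro cSup_least) auto
  moreover have "left_end Is j \<le> Inf (Is ! j \<union> Is ! Suc j)"
  proof (rule cInf_greatest)
    show "Is ! j \<union> Is ! Suc j \<noteq> {}" using I(1) by blast
    fix x assume x: "x \<in> Is ! j \<union> Is ! Suc j"
    obtain y where y: "y \<in> Is ! j" using I(1) by blast
    have inf: "Inf (Is ! j) \<le> a" if "a \<in> Is ! j" for a
      using that I(5) by (rule cInf_lower)
    have "y \<le> x" if "x \<in> Is ! Suc j"
      using unit_partition_nth_less[OF assms(1) _ assms(2) y that] by simp
    then have "Inf (Is ! j) \<le> x"
      using x inf[of x] inf[OF y] by auto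
    then show "left_end Is j \<le> x" using j by (auto simp: left_end_def)
  qed
  ultimately show ?thesis by (simp add: extent_def)
qed

lemma card_long_parts:
  assumes "unit_partition Is" and "w > 0"
  shows "real (card {I \<in> set Is. w \<le> extent I}) * w \<le> 1"
proof -
  let ?L = "{j. j < length Is \<and> w \<le> extent (Is ! j)}"
  have ext0: "0 \<le> extent (Is ! j)" if "j < length Is" for j
    using extent_nonneg unit_partition_member[OF assms(1) nth_mem[OF that]] by blast
  have "{I \<in> set Is. w \<le> extent I} \<subseteq> (!) Is ` ?L"
    by (auto simp: in_set_conv_nth)
  then have "card {I \<in> set Is. w \<le> extent I} \<le> card ?L"
    by (intro surj_card_le) auto
  then have "real (card {I \<in> set Is. w \<le> extent I}) * w \<le> real (card ?L) * w"
    using assms(2) by simp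
  also have "\<dots> \<le> (\<Sum>j\<in>?L. extent (Is ! j))"
    using sum_bounded_below[of ?L w "\<lambda>j. extent (Is ! j)"] by simp
  also have "\<dots> \<le> (\<Sum>j<length Is. extent (Is ! j))"
    by (rule sum_mono2) (auto intro: ext0)
  also have "\<dots> \<le> (\<Sum>j<length Is. left_end Is (Suc j) - left_end Is j)"
    by (intro sum_mono extent_le_left_end_diff assms(1)) simp
  also have "\<dots> = left_end Is (length Is) - left_end Is 0"
    by (rule sum_lessThan_telescope)
  also have "\<dots> \<le> 1"
    using left_end_bounds[OF assms(1)] by (smt (verit))
  finally show ?thesis .
qed

lemma unit_partition_join:
  assumes "unit_partition (As @ I # J # Bs)"
  shows "unit_partition (As @ (I \<union> J) # Bs)"
proof -
  have sorted: "sorted_wrt (\<lambda>I J. \<forall>x\<in>I. \<forall>y\<in>J. x < y) (As @ I # J # Bs)"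
    and union: "\<Union> (set (As @ I # J # Bs)) = {0..1}"
    and mem: "\<And>K. K \<in> set (As @ I # J # Bs) \<Longrightarrow> is_interval K \<and> K \<noteq> {}"
    using assms by (auto simp: unit_partition_def)
  have before: "a < b" if "K \<in> set As" "a \<in> K" "b \<in> I \<union> J" for K a b
    using sorted that by (auto simp: sorted_wrt_append)
  have after: "a < b" if "K \<in> set Bs" "a \<in> I \<union> J" "b \<in> K" for K a b
    using sorted that by (auto simp: sorted_wrt_append)
  have "is_interval (I \<union> J)"
    unfolding is_interval_1
  proof (intro ballI allI impI, elim conjE)
    fix x z y assume xz: "x \<in> I \<union> J" "z \<in> I \<union> J" "x \<le> y" "y \<le> z"
    have "x \<in> {0..1}" "z \<in> {0..1}" using xz(1,2) union by auto
    then have "y \<in> \<Union> (set (As @ I # J # Bs))" unfolding union using xz(3,4) by auto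
    then obtain K where "K \<in> set As \<or> K = I \<or> K = J \<or> K \<in> set Bs" "y \<in> K" by auto
    moreover have "K \<notin> set As" "K \<notin> set Bs"
      using before[of K y x] after[of K z y] xz \<open>y \<in> K\<close> by auto
    ultimately show "y \<in> I \<union> J" by blast
  qed
  moreover have "sorted_wrt (\<lambda>I J. \<forall>x\<in>I. \<forall>y\<in>J. x < y) (As @ (I \<union> J) # Bs)"
    using sorted by (auto simp: sorted_wrt_append)
  moreover have "\<Union> (set (As @ (I \<union> J) # Bs)) = {0..1}"
    using union by (auto simp: Un_assoc)
  ultimately show ?thesis
    using mem by (auto simp: unit_partition_def)
qed

text \<open>The parts are the level sets of the rank divided by \<open>m\<close>.\<close>

lemma unit_partition_equitable:
  assumes "finite X" and "X \<noteq> {}" and "X \<subseteq> {0..1}" and "m > 0"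
  obtains Is where "unit_partition Is" and "\<And>I. I \<in> set Is \<Longrightarrow> card (X \<inter> I) \<le> m"
    and "(length Is - 1) * m \<le> card X"
proof -
  define rank where "rank x = card {y \<in> X. y < x}" for x
  define g where "g x = min (rank x) (card X - 1) div m" for x
  define p where "p = Suc ((card X - 1) div m)"
  define part where "part j = {x \<in> {0..1}. g x = j}" for j
  define Is where "Is = map part [0..<p]"
  have card_X: "card X > 0" using assms(1,2) by (simp add: card_gt_0_iff)
  have rank_mono: "rank x \<le> rank y" if "x \<le> y" for x y
    unfolding rank_def using assms(1) that by (intro card_mono) auto
  have g_mono: "g x \<le> g y" if "x \<le> y" for x y
    unfolding g_def using rank_mono[OF that] by (intro div_le_mono) auto
  have rank_less: "rank x < rank y" if "x < y" "x \<in> X" for x y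
    unfolding rank_def using assms(1) that by (intro psubset_card_mono) auto
  have rank_bound: "rank x < card X" if "x \<in> X" for x
    unfolding rank_def using assms(1) that by (intro psubset_card_mono) auto
  have inj: "inj_on rank X"
    by (rule inj_onI) (metis linorder_cases order_less_irrefl rank_less)
  have "rank ` X = {..<card X}"
    by (rule card_subset_eq) (use rank_bound card_image[OF inj] in auto)
  have "unit_partition Is"
    unfolding unit_partition_def
  proof (intro conjI ballI)
    fix I assume "I \<in> set Is"
    then obtain j where j: "j < p" "I = part j" by (auto simp: Is_def)
    show "is_interval I"
      unfolding is_interval_1
    proof (intro ballI allI impI, elim conjE)
      fix x z y assume xz: "x \<in> I" "z \<in> I" "x \<le> y" "y \<le> z"
      then show "y \<in> I" using g_mono[OF xz(3)] g_mono[OF xz(4)] by (auto simp: j part_def)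
    qed
    have jm: "j * m \<le> card X - 1"
      using j(1) assms(4) by (simp add: p_def less_Suc_eq_le less_eq_div_iff_mult_less_eq)
    then have "j * m \<in> rank ` X"
      unfolding \<open>rank ` X = {..<card X}\<close> using card_X by auto
    then obtain x where "x \<in> X" "rank x = j * m" by auto
    then have "x \<in> part j"
      using jm assms(3,4) by (auto simp: part_def g_def min_def)
    then show "I \<noteq> {}" using j by blast
  next
    show "sorted_wrt (\<lambda>I J. \<forall>x\<in>I. \<forall>y\<in>J. x < y) Is"
      unfolding sorted_wrt_iff_nth_less
    proof (intro allI impI ballI)
      fix i j x y assume "i < j" "j < length Is" "x \<in> Is ! i" "y \<in> Is ! j"
      then have "g x < g y" by (auto simp: Is_def part_def)
      then show "x < y" using g_mono[of y x] by (meson leD leI)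
    qed
    have "g x < p" for x
      by (simp add: g_def p_def less_Suc_eq_le div_le_mono)
    then show "\<Union> (set Is) = {0..1}"
      by (auto simp: Is_def part_def)
  qed
  moreover have "card (X \<inter> I) \<le> m" if "I \<in> set Is" for I
  proof -
    obtain j where j: "I = part j" using \<open>I \<in> set Is\<close> by (auto simp: Is_def)
    have "rank ` (X \<inter> I) \<subseteq> {r. r div m = j}"
    proof clarify
      fix x assume "x \<in> X" "x \<in> I"
      then show "rank x div m = j"
        using rank_bound[of x] by (simp add: j part_def g_def)
    qed
    then have "rank ` (X \<inter> I) \<subseteq> {j * m..<j * m + m}"
      by (simp only: div_eq_atLeastLessThan[OF assms(4)])
    then have "card (rank ` (X \<inter> I)) \<le> m"
      using card_mono[of "{j * m..<j * m + m}"] by fastforce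
    then show ?thesis
      using card_image[OF inj_on_subset[OF inj, of "X \<inter> I"]] by simp
  qed
  moreover have "(length Is - 1) * m \<le> card X"
    by (simp add: Is_def p_def) (metis diff_le_self div_times_less_eq_dividend order_trans)
  ultimately show ?thesis using that by blast
qed


subsection \<open>Balanced partitions\<close>

text \<open>
  One coordinate direction of the invariant: \<open>f\<close> is the projection to that coordinate.
\<close>

definition balanced :: "(point \<Rightarrow> real) \<Rightarrow> real \<Rightarrow> point set \<Rightarrow> point set set \<Rightarrow> real set list \<Rightarrow> bool" where
  "balanced f c P F Is \<longleftrightarrow> unit_partition Is \<and>
     (\<forall>R\<in>F. \<exists>I\<in>set Is. f ` R \<subseteq> I) \<and>
     (\<forall>R\<in>F. extent (f ` R) < 20 / real (length Is)) \<and>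
     (\<forall>I\<in>set Is. real (card {R \<in> F. f ` R \<subseteq> I}) \<le> 5 * c) \<and>
     (\<forall>I\<in>set Is. 20 / real (length Is) \<le> extent I \<longrightarrow> real (card {z \<in> P. f z \<in> I}) \<le> 5 * c)"

lemma sum_card_parts_le:
  assumes Is: "unit_partition Is" and "finite F" and "{} \<notin> F"
  shows "(\<Sum>j<length Is. card {R \<in> F. f ` R \<subseteq> Is ! j}) \<le> card F"
proof -
  have "(\<Sum>j<length Is. card {R \<in> F. f ` R \<subseteq> Is ! j}) = card (\<Union>j<length Is. {R \<in> F. f ` R \<subseteq> Is ! j})"
  proof (rule card_UN_disjoint[symmetric])
    show "\<forall>i\<in>{..<length Is}. \<forall>j\<in>{..<length Is}. i \<noteq> j \<longrightarrow>
        {R \<in> F. f ` R \<subseteq> Is ! i} \<inter> {R \<in> F. f ` R \<subseteq> Is ! j} = {}"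
    proof (intro ballI impI equals0I)
      fix i j R assume "i \<in> {..<length Is}" "j \<in> {..<length Is}" "i \<noteq> j"
        and R: "R \<in> {R \<in> F. f ` R \<subseteq> Is ! i} \<inter> {R \<in> F. f ` R \<subseteq> Is ! j}"
      moreover obtain z where "z \<in> R" using R assms(3) by fastforce
      ultimately have "f z \<in> Is ! i" "f z \<in> Is ! j" by auto
      then show False
        using unit_partition_nth_less[OF Is, of i j "f z" "f z"]
          unit_partition_nth_less[OF Is, of j i "f z" "f z"] \<open>i \<noteq> j\<close>
          \<open>i \<in> {..<length Is}\<close> \<open>j \<in> {..<length Is}\<close> by (cases i j rule: linorder_cases) auto
    qed
  qed (use assms(2) in auto)
  also have "\<dots> \<le> card F" using assms(2) by (intro card_mono) auto
  finally show ?thesis .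
qed

lemma card_le_parts:
  assumes "balanced f c P F Is" and "finite F"
  shows "real (card F) \<le> 5 * c * real (length Is)"
proof -
  have F: "(\<Union>j<length Is. {R \<in> F. f ` R \<subseteq> Is ! j}) = F"
    using assms(1) by (fastforce simp: balanced_def in_set_conv_nth)
  have "card F \<le> (\<Sum>j<length Is. card {R \<in> F. f ` R \<subseteq> Is ! j})"
    by (rule card_UN_le[of "{..<length Is}" "\<lambda>j. {R \<in> F. f ` R \<subseteq> Is ! j}", unfolded F]) (rule finite_lessThan)
  then have "real (card F) \<le> (\<Sum>j<length Is. real (card {R \<in> F. f ` R \<subseteq> Is ! j}))"
    unfolding of_nat_sum[symmetric] of_nat_le_iff .
  also have "\<dots> \<le> (\<Sum>j<length Is. 5 * c)"
    using assms(1) by (intro sum_mono) (auto simp: balanced_def)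
  finally show ?thesis by (simp add: mult.commute)
qed

lemma sum_second_differences:
  fixes g :: "nat \<Rightarrow> real"
  shows "(\<Sum>j<m. g (Suc (Suc j)) - g j) = g (Suc m) + g m - g 1 - g 0"
  by (induction m) auto

text \<open>
  Averaging over the \<open>m\<close> pairs of adjacent parts: the pair counts add up to less than \<open>4.5 c m\<close>
  and the pair widths to at most 2, so some pair has count at most \<open>5 c\<close> and width below \<open>20 / m\<close>.
\<close>

lemma exists_joinable_pair:
  assumes Is: "unit_partition Is" and "finite F" and "{} \<notin> F" and "c > 0"
    and m: "length Is = Suc m" and F: "real (card F) < 9 / 4 * c * real m"
  obtains j where "j < m" and "extent (Is ! j \<union> Is ! Suc j) < 20 / real m"
    and "real (card {R \<in> F. f ` R \<subseteq> Is ! j} + card {R \<in> F. f ` R \<subseteq> Is ! Suc j}) \<le> 5 * c"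
proof (rule ccontr)
  note pair = that
  assume contra: "\<not> thesis"
  define cnt where "cnt j = real (card {R \<in> F. f ` R \<subseteq> Is ! j})" for j
  define w where "w j = left_end Is (Suc (Suc j)) - left_end Is j" for j
  have m0: "m > 0" using F by (cases m) auto
  have ext: "extent (Is ! j \<union> Is ! Suc j) \<le> w j" if "j < m" for j
    unfolding w_def using that m by (intro extent_union_le_left_end_diff[OF Is]) simp
  have "0 \<le> w j" if "j < m" for j
  proof -
    have "j < length Is" "Suc j < length Is" using that m by auto
    then have "0 \<le> extent (Is ! j \<union> Is ! Suc j)"
      using unit_partition_member[OF Is, of "Is ! j"] unit_partition_member[OF Is, of "Is ! Suc j"]
      by (intro extent_nonneg) auto
    then show ?thesis using ext[OF that] by simp
  qed
  note w_nonneg = this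
  have "1 \<le> (cnt j + cnt (Suc j)) / (5 * c) + w j * (real m / 20)" if "j < m" for j
  proof (cases "extent (Is ! j \<union> Is ! Suc j) < 20 / real m")
    case True
    then have "5 * c < cnt j + cnt (Suc j)"
      using contra pair[OF \<open>j < m\<close>] unfolding cnt_def by fastforce
    then have "1 \<le> (cnt j + cnt (Suc j)) / (5 * c)" using \<open>c > 0\<close> by simp
    moreover have "0 \<le> w j * (real m / 20)" using w_nonneg[OF \<open>j < m\<close>] by simp
    ultimately show ?thesis by linarith
  next
    case False
    then have "20 / real m \<le> w j" using ext[OF \<open>j < m\<close>] by simp
    then have "1 \<le> w j * (real m / 20)" using m0 by (simp add: field_simps)
    moreover have "0 \<le> (cnt j + cnt (Suc j)) / (5 * c)" using \<open>c > 0\<close> by (simp add: cnt_def)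
    ultimately show ?thesis by linarith
  qed
  then have "(\<Sum>j<m. 1) \<le> (\<Sum>j<m. (cnt j + cnt (Suc j)) / (5 * c) + w j * (real m / 20))"
    by (intro sum_mono) simp
  also have "\<dots> = ((\<Sum>j<m. cnt j) + (\<Sum>j<m. cnt (Suc j))) / (5 * c) + (\<Sum>j<m. w j) * (real m / 20)"
    by (simp add: sum.distrib sum_divide_distrib sum_distrib_right add_divide_distrib)
  finally have 1: "real m \<le> ((\<Sum>j<m. cnt j) + (\<Sum>j<m. cnt (Suc j))) / (5 * c) + (\<Sum>j<m. w j) * (real m / 20)"
    by simp
  have "(\<Sum>j<Suc m. cnt j) \<le> real (card F)"
    using sum_card_parts_le[OF Is assms(2,3), of f] unfolding m cnt_def of_nat_sum[symmetric] of_nat_le_iff .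
  moreover have "(\<Sum>j<m. cnt j) \<le> (\<Sum>j<Suc m. cnt j)"
    by (simp add: cnt_def)
  moreover have "(\<Sum>j<m. cnt (Suc j)) \<le> (\<Sum>j<Suc m. cnt j)"
    unfolding sum.lessThan_Suc_shift by (simp add: cnt_def)
  ultimately have "(\<Sum>j<m. cnt j) + (\<Sum>j<m. cnt (Suc j)) < 9 / 2 * c * real m"
    using F by simp
  then have "((\<Sum>j<m. cnt j) + (\<Sum>j<m. cnt (Suc j))) / (5 * c) < 9 / 10 * real m"
    using \<open>c > 0\<close> by (simp add: field_simps)
  moreover have "(\<Sum>j<m. w j) \<le> 2"
    unfolding w_def sum_second_differences
    using left_end_bounds[OF Is, of "Suc m"] left_end_bounds[OF Is, of m]
      left_end_bounds[OF Is, of 1] left_end_bounds[OF Is, of 0] by linarith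
  then have "(\<Sum>j<m. w j) * (real m / 20) \<le> 2 * (real m / 20)"
    by (rule mult_right_mono) simp
  ultimately show False using 1 by linarith
qed

lemma balanced_coarsen:
  assumes bal: "balanced f c P F Is" and "finite F" and "{} \<notin> F" and "c > 0"
    and F: "real (card F) < 9 / 4 * c * (real (length Is) - 1)"
  obtains Js where "balanced f c P F Js" and "Suc (length Js) = length Is"
proof -
  have Is: "unit_partition Is" using bal by (simp add: balanced_def)
  obtain m where m: "length Is = Suc m"
    using unit_partition_nonempty[OF Is] by (cases "length Is") auto
  have m0: "m > 0" using F m by (cases m) auto
  obtain j where j: "j < m" and ext: "extent (Is ! j \<union> Is ! Suc j) < 20 / real m"
    and cnt: "real (card {R \<in> F. f ` R \<subseteq> Is ! j} + card {R \<in> F. f ` R \<subseteq> Is ! Suc j}) \<le> 5 * c"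
    using exists_joinable_pair[OF Is assms(2-4) m, of f] F m by auto
  define I J As Bs where "I = Is ! j" and "J = Is ! Suc j" and "As = take j Is" and "Bs = drop (Suc (Suc j)) Is"
  have split: "Is = As @ I # J # Bs"
    using j m by (simp add: I_def J_def As_def Bs_def Cons_nth_drop_Suc)
  define Js where "Js = As @ (I \<union> J) # Bs"
  have Js: "unit_partition Js"
    unfolding Js_def using Is split by (intro unit_partition_join) simp
  have length: "length Js = m" using m split by (simp add: Js_def)
  have mono: "20 / real (length Is) \<le> 20 / real m"
    using m m0 by (simp add: field_simps)
  have part: "\<exists>K\<in>set Is. f ` R \<subseteq> K" if "R \<in> F" for R
    using bal that by (auto simp: balanced_def)
  have union: "{R \<in> F. f ` R \<subseteq> I \<union> J} \<subseteq> {R \<in> F. f ` R \<subseteq> I} \<union> {R \<in> F. f ` R \<subseteq> J}"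
  proof
    fix R assume "R \<in> {R \<in> F. f ` R \<subseteq> I \<union> J}"
    then have R: "R \<in> F" "f ` R \<subseteq> I \<union> J" by auto
    obtain K where K: "K \<in> set Is" "f ` R \<subseteq> K" using part[OF R(1)] by blast
    obtain z where "z \<in> R" using R(1) assms(3) by (metis ex_in_conv)
    then have "f z \<in> K" "f z \<in> I \<or> f z \<in> J" using K R(2) by auto
    then have "K = I \<or> K = J"
      using unit_partition_unique[OF Is K(1), of _ "f z"] split by auto
    then show "R \<in> {R \<in> F. f ` R \<subseteq> I} \<union> {R \<in> F. f ` R \<subseteq> J}" using K R(1) by blast
  qed
  have "card {R \<in> F. f ` R \<subseteq> I \<union> J} \<le> card ({R \<in> F. f ` R \<subseteq> I} \<union> {R \<in> F. f ` R \<subseteq> J})"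
    using assms(2) by (intro card_mono[OF _ union]) auto
  also have "\<dots> \<le> card {R \<in> F. f ` R \<subseteq> I} + card {R \<in> F. f ` R \<subseteq> J}" by (rule card_Un_le)
  finally have card_union: "real (card {R \<in> F. f ` R \<subseteq> I \<union> J}) \<le> 5 * c"
    using cnt by (simp add: I_def J_def)
  have set_Js: "K \<in> set Is \<or> K = I \<union> J" if "K \<in> set Js" for K
    using that split by (auto simp: Js_def)
  have "balanced f c P F Js"
    unfolding balanced_def length
  proof (intro conjI ballI impI)
    show "unit_partition Js" by (rule Js)
    fix R assume R: "R \<in> F"
    show "\<exists>K\<in>set Js. f ` R \<subseteq> K"
      using part[OF R] split by (auto simp: Js_def)
    show "extent (f ` R) < 20 / real m"
      using bal R mono by (fastforce simp: balanced_def)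
  next
    fix K assume "K \<in> set Js"
    from set_Js[OF this] show "real (card {R \<in> F. f ` R \<subseteq> K}) \<le> 5 * c"
      using bal card_union by (auto simp: balanced_def)
  next
    fix K assume K: "K \<in> set Js" "20 / real m \<le> extent K"
    then have "K \<noteq> I \<union> J" using ext by (auto simp: I_def J_def)
    then have "K \<in> set Is" using set_Js[OF K(1)] by simp
    then show "real (card {z \<in> P. f z \<in> K}) \<le> 5 * c"
      using bal K(2) mono by (auto simp: balanced_def)
  qed
  then show ?thesis using that length m by simp
qed

lemma balanced_merge:
  assumes bal: "balanced f c P F Is" and "finite F" and "R \<in> F" and "S \<in> F" and "R \<noteq> S"
    and I: "I \<in> set Is" "f ` R \<subseteq> I" "f ` S \<subseteq> I" "f ` B \<subseteq> I" and "B \<noteq> {}"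
    and ext: "extent (f ` B) < 20 / real (length Is)"
  shows "balanced f c P (insert B (F - {R, S})) Is"
  unfolding balanced_def
proof (intro conjI ballI impI)
  show Is: "unit_partition Is" using bal by (simp add: balanced_def)
  fix T assume "T \<in> insert B (F - {R, S})"
  then show "\<exists>I\<in>set Is. f ` T \<subseteq> I" "extent (f ` T) < 20 / real (length Is)"
    using bal I ext by (auto simp: balanced_def)
next
  fix K assume K: "K \<in> set Is" "20 / real (length Is) \<le> extent K"
  then show "real (card {z \<in> P. f z \<in> K}) \<le> 5 * c" using bal by (auto simp: balanced_def)
next
  fix K assume K: "K \<in> set Is"
  have "card {T \<in> insert B (F - {R, S}). f ` T \<subseteq> K} \<le> card {T \<in> F. f ` T \<subseteq> K}"
  proof (cases "f ` B \<subseteq> K")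
    case True
    obtain z where "z \<in> B" using \<open>B \<noteq> {}\<close> by blast
    then have "f z \<in> K" "f z \<in> I" using True I(4) by auto
    moreover have "unit_partition Is" using bal by (simp add: balanced_def)
    ultimately have "K = I" using unit_partition_unique[OF _ K I(1)] by blast
    let ?C = "{T \<in> F. f ` T \<subseteq> K}"
    have "{T \<in> insert B (F - {R, S}). f ` T \<subseteq> K} \<subseteq> insert B (?C - {R})" by auto
    then have "card {T \<in> insert B (F - {R, S}). f ` T \<subseteq> K} \<le> card (insert B (?C - {R}))"
      using assms(2) by (intro card_mono) auto
    also have "\<dots> \<le> Suc (card (?C - {R}))" by (rule card_insert_le_m1) auto
    also have "\<dots> = card ?C"
      using assms(2,3) I \<open>K = I\<close> by (intro card_Suc_Diff1) auto
    finally show ?thesis .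
  next
    case False
    then show ?thesis using assms(2) by (intro card_mono) auto
  qed
  then show "real (card {T \<in> insert B (F - {R, S}). f ` T \<subseteq> K}) \<le> 5 * c"
    using bal K by (fastforce simp: balanced_def)
qed


subsection \<open>Rectangle families\<close>

definition is_rectangle :: "point set \<Rightarrow> bool" where
  "is_rectangle R \<longleftrightarrow> (\<exists>a b c d. a \<le> b \<and> c \<le> d \<and> R = {a..b} \<times> {c..d})"

text \<open>
  By general position, distinct rectangles of a merge sequence have distinct left sides. Hence a
  new bounding box never coincides with another member of the family, so that a merge step
  decreases the cardinality by exactly one.
\<close>

definition rectangle_family :: "point set \<Rightarrow> point set set \<Rightarrow> bool" where
  "rectangle_family P F \<longleftrightarrow> finite F \<and>
     (\<forall>R\<in>F. is_rectangle R) \<and>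
     (\<forall>z\<in>P. \<exists>R\<in>F. z \<in> R) \<and> (\<forall>R\<in>F. R \<inter> P \<noteq> {}) \<and> inj_on (\<lambda>R. Inf (fst ` R)) F"

lemma rectangle_familyE:
  assumes "rectangle_family P F" and "R \<in> F"
  obtains a b c d where "a \<le> b" "c \<le> d" "R = {a..b} \<times> {c..d}"
  using assms unfolding rectangle_family_def is_rectangle_def by metis

lemma bounding_box_union:
  fixes a b c d a' b' c' d' :: real
  assumes "a \<le> b" "c \<le> d" "a' \<le> b'" "c' \<le> d'"
  shows "bounding_box ({a..b} \<times> {c..d} \<union> {a'..b'} \<times> {c'..d'})
    = {min a a'..max b b'} \<times> {min c c'..max d d'}"
proof -
  have "fst ` ({a..b} \<times> {c..d} \<union> {a'..b'} \<times> {c'..d'}) = {a..b} \<union> {a'..b'}"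
    "snd ` ({a..b} \<times> {c..d} \<union> {a'..b'} \<times> {c'..d'}) = {c..d} \<union> {c'..d'}"
    using assms by (simp_all add: image_Un fst_image_times snd_image_times)
  moreover have "Inf ({x..y} \<union> {x'..y'}) = min x x'" "Sup ({x..y} \<union> {x'..y'}) = max y y'"
    if "x \<le> y" "x' \<le> y'" for x y x' y' :: real
    using that by (simp_all add: cInf_union_distrib cSup_union_distrib inf_min sup_max)
  ultimately show ?thesis
    using assms by (simp add: bounding_box_def)
qed

lemma bounding_box_subset_cell:
  assumes R: "a \<le> b" "c \<le> d" "R = {a..b} \<times> {c..d}" and S: "a' \<le> b'" "c' \<le> d'" "S = {a'..b'} \<times> {c'..d'}"
    and I: "is_interval I" and J: "is_interval J" and "R \<subseteq> I \<times> J" and "S \<subseteq> I \<times> J"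
  shows "bounding_box (R \<union> S) \<subseteq> I \<times> (J :: real set)"
proof -
  have "(a, c) \<in> R" "(b, d) \<in> R" "(a', c') \<in> S" "(b', d') \<in> S" using R S by auto
  then have "a \<in> I" "b \<in> I" "a' \<in> I" "b' \<in> I" "c \<in> J" "d \<in> J" "c' \<in> J" "d' \<in> J"
    using assms(9,10) by auto
  then have "min a a' \<in> I" "max b b' \<in> I" "min c c' \<in> J" "max d d' \<in> J"
    by (auto simp: min_def max_def)
  then have "{min a a'..max b b'} \<subseteq> I" "{min c c'..max d d'} \<subseteq> J"
    using I J unfolding is_interval_1 by (meson atLeastAtMost_iff subsetI)+
  then show ?thesis using R S by (auto simp: bounding_box_union)
qed

lemma rectangle_family_merge:
  assumes F: "rectangle_family P F" and RS: "R \<in> F" "S \<in> F" "R \<noteq> S"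
  shows "rectangle_family P (insert (bounding_box (R \<union> S)) (F - {R, S}))"
    and "Suc (card (insert (bounding_box (R \<union> S)) (F - {R, S}))) = card F"
    and "bounding_box (R \<union> S) \<noteq> {}"
proof -
  obtain a b c d where R: "a \<le> b" "c \<le> d" "R = {a..b} \<times> {c..d}"
    using rectangle_familyE[OF F RS(1)] .
  obtain a' b' c' d' where S: "a' \<le> b'" "c' \<le> d'" "S = {a'..b'} \<times> {c'..d'}"
    using rectangle_familyE[OF F RS(2)] .
  define B where "B = bounding_box (R \<union> S)"
  have B: "B = {min a a'..max b b'} \<times> {min c c'..max d d'}"
    unfolding B_def R(3) S(3) by (rule bounding_box_union[OF R(1,2) S(1,2)])
  have le: "min a a' \<le> max b b'" "min c c' \<le> max d d'" using R S by auto
  have sub: "R \<union> S \<subseteq> B" unfolding B using R S by auto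
  show "bounding_box (R \<union> S) \<noteq> {}"
    using sub R unfolding B_def by auto
  have inj: "inj_on (\<lambda>R. Inf (fst ` R)) F" and fin: "finite F"
    using F by (auto simp: rectangle_family_def)
  have "Inf (fst ` B) = Inf (fst ` R) \<or> Inf (fst ` B) = Inf (fst ` S)"
    unfolding B using R S le by (simp add: fst_image_times min_def)
  then have new: "Inf (fst ` B) \<noteq> Inf (fst ` T)" if "T \<in> F - {R, S}" for T
    using that RS inj_onD[OF inj, of T R] inj_onD[OF inj, of T S] by auto
  have "inj_on (\<lambda>R. Inf (fst ` R)) (insert B (F - {R, S}))"
    using new inj_on_subset[OF inj, of "F - {R, S}"] by (auto simp: inj_on_insert)
  moreover have "is_rectangle B"
    unfolding is_rectangle_def B using le by blast
  then have "is_rectangle T" if "T \<in> insert B (F - {R, S})" for T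
    using that F by (auto simp: rectangle_family_def)
  moreover have "\<exists>T\<in>insert B (F - {R, S}). z \<in> T" if "z \<in> P" for z
  proof -
    obtain T where "T \<in> F" "z \<in> T" using F \<open>z \<in> P\<close> unfolding rectangle_family_def by blast
    then show ?thesis using sub by (cases "T \<in> {R, S}") auto
  qed
  moreover have "T \<inter> P \<noteq> {}" if "T \<in> insert B (F - {R, S})" for T
  proof (cases "T = B")
    case True
    have "R \<inter> P \<noteq> {}" using F RS by (auto simp: rectangle_family_def)
    then show ?thesis using True sub by blast
  next
    case False
    then show ?thesis using F that by (auto simp: rectangle_family_def)
  qed
  ultimately show "rectangle_family P (insert (bounding_box (R \<union> S)) (F - {R, S}))"
    using fin unfolding rectangle_family_def B_def[symmetric] by simp
  have "B \<notin> F - {R, S}" using new by blast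
  then have "card (insert B (F - {R, S})) = Suc (card (F - {R, S}))" using fin by simp
  moreover have "card (F - {R, S}) = card F - 2"
    using RS fin by (subst card_Diff_subset) auto
  moreover have "card F \<ge> 2"
    using card_mono[OF fin, of "{R, S}"] RS by simp
  ultimately show "Suc (card (insert (bounding_box (R \<union> S)) (F - {R, S}))) = card F"
    by (simp add: B_def)
qed

lemma rectangle_family_nonempty: "rectangle_family P F \<Longrightarrow> {} \<notin> F"
  unfolding rectangle_family_def by blast

subsection \<open>The invariant\<close>

definition balanced_state :: "real \<Rightarrow> point set \<Rightarrow> point set set \<Rightarrow> gridding \<Rightarrow> bool" where
  "balanced_state c P F G \<longleftrightarrow> rectangle_family P F \<and>
     balanced fst c P F (fst G) \<and> balanced snd c P F (snd G) \<and>
     9 / 4 * c * (real (num_columns G) - 1) \<le> real (card F) \<and>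
     9 / 4 * c * (real (num_rows G) - 1) \<le> real (card F)"

lemma real_card_UN_le:
  assumes "finite X" and "\<And>x. x \<in> X \<Longrightarrow> real (card (f x)) \<le> b"
  shows "real (card (\<Union>x\<in>X. f x)) \<le> real (card X) * b"
proof -
  have "real (card (\<Union>x\<in>X. f x)) \<le> real (\<Sum>x\<in>X. card (f x))"
    using card_UN_le[OF assms(1)] of_nat_le_iff by blast
  also have "\<dots> \<le> (\<Sum>x\<in>X. b)" unfolding of_nat_sum by (intro sum_mono assms(2))
  finally show ?thesis by simp
qed

text \<open>
  Columns of width at least \<open>20 / p\<close> number at most \<open>p / 20\<close> and contain at most \<open>5 c\<close> rectangles
  each; likewise for rows. The remaining rectangles would otherwise inject into the non-empty
  cells, of which there are at most \<open>c max p q\<close>; but \<open>1.5 c max p q\<close> is less than the number of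
  rectangles unless \<open>max p q \<le> 3\<close>, in which case there are no wide columns or rows at all.
\<close>

lemma exists_mergeable_pair:
  assumes st: "balanced_state c P F (Is, Js)" and "finite P" and "c \<ge> 1" and "card F \<ge> 2"
    and cells: "real (card {(I, J) \<in> set Is \<times> set Js. (I \<times> J) \<inter> P \<noteq> {}})
      \<le> c * real (max (length Is) (length Js))"
  obtains R S I J where "R \<in> F" "S \<in> F" "R \<noteq> S" "I \<in> set Is" "J \<in> set Js"
    "R \<subseteq> I \<times> J" "S \<subseteq> I \<times> J" "extent I < 20 / real (length Is)" "extent J < 20 / real (length Js)"
proof (rule ccontr)
  note pair = that
  assume contra: "\<not> thesis"
  define p q where "p = real (length Is)" and "q = real (length Js)"
  have F: "rectangle_family P F" and bI: "balanced fst c P F Is" and bJ: "balanced snd c P F Js"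
    and card_F: "9 / 4 * c * (p - 1) \<le> real (card F)" "9 / 4 * c * (q - 1) \<le> real (card F)"
    using st by (auto simp: balanced_state_def p_def q_def)
  have Is: "unit_partition Is" and Js: "unit_partition Js"
    using bI bJ by (auto simp: balanced_def)
  have pq1: "p \<ge> 1" "q \<ge> 1"
    using unit_partition_nonempty[OF Is] unit_partition_nonempty[OF Js] by (auto simp: p_def q_def)
  have fin: "finite F" using F by (simp add: rectangle_family_def)
  define X Y where "X = {I \<in> set Is. 20 / p \<le> extent I}" and "Y = {J \<in> set Js. 20 / q \<le> extent J}"
  have X: "real (card X) \<le> p / 20" and Y: "real (card Y) \<le> q / 20"
    using card_long_parts[OF Is, of "20 / p"] card_long_parts[OF Js, of "20 / q"] pq1
    by (simp_all add: X_def Y_def field_simps)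
  define FX FY where "FX = (\<Union>I\<in>X. {R \<in> F. fst ` R \<subseteq> I})" and "FY = (\<Union>J\<in>Y. {R \<in> F. snd ` R \<subseteq> J})"
  have FX: "real (card FX) \<le> real (card X) * (5 * c)"
    unfolding FX_def by (rule real_card_UN_le) (use bI in \<open>auto simp: X_def balanced_def\<close>)
  have FY: "real (card FY) \<le> real (card Y) * (5 * c)"
    unfolding FY_def by (rule real_card_UN_le) (use bJ in \<open>auto simp: Y_def balanced_def\<close>)
  define C where "C = {(I, J) \<in> set Is \<times> set Js. (I \<times> J) \<inter> P \<noteq> {}}"
  define G where "G = {R \<in> F. \<exists>I\<in>set Is - X. \<exists>J\<in>set Js - Y. R \<subseteq> I \<times> J}"
  have finC: "finite C"
    by (rule finite_subset[of _ "set Is \<times> set Js"]) (auto simp: C_def)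
  have "\<forall>R\<in>G. \<exists>I\<in>set Is - X. \<exists>J\<in>set Js - Y. R \<subseteq> I \<times> J" by (auto simp: G_def)
  then obtain cI cJ where cell: "\<And>R. R \<in> G \<Longrightarrow> cI R \<in> set Is - X \<and> cJ R \<in> set Js - Y \<and> R \<subseteq> cI R \<times> cJ R"
    by metis
  have "inj_on (\<lambda>R. (cI R, cJ R)) G"
  proof (rule inj_onI, rule ccontr)
    fix R S assume "R \<in> G" "S \<in> G" "(cI R, cJ R) = (cI S, cJ S)" "R \<noteq> S"
    moreover have "R \<in> F" "S \<in> F" using \<open>R \<in> G\<close> \<open>S \<in> G\<close> by (auto simp: G_def)
    ultimately have thesis
      using pair[of R S "cI R" "cJ R"] cell[of R] cell[of S]
      unfolding X_def Y_def p_def q_def by (simp add: not_le)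
    with contra show False ..
  qed
  moreover have "(\<lambda>R. (cI R, cJ R)) ` G \<subseteq> C"
  proof clarify
    fix R assume "R \<in> G"
    then have "R \<inter> P \<noteq> {}" using F by (auto simp: G_def rectangle_family_def)
    then show "(cI R, cJ R) \<in> C" using cell[OF \<open>R \<in> G\<close>] by (auto simp: C_def)
  qed
  ultimately have G: "card G \<le> card C"
    using card_inj_on_le[OF _ _ finC] by blast
  have "F \<subseteq> FX \<union> FY \<union> G"
  proof
    fix R assume R: "R \<in> F"
    obtain I where I: "I \<in> set Is" "fst ` R \<subseteq> I" using bI R by (auto simp: balanced_def)
    obtain J where J: "J \<in> set Js" "snd ` R \<subseteq> J" using bJ R by (auto simp: balanced_def)
    have "R \<subseteq> I \<times> J" using I J by force
    then show "R \<in> FX \<union> FY \<union> G"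
      using R I J unfolding FX_def FY_def G_def by (cases "I \<in> X"; cases "J \<in> Y") blast+
  qed
  moreover have "finite (FX \<union> FY \<union> G)"
    using fin by (auto simp: FX_def FY_def G_def X_def Y_def)
  ultimately have "card F \<le> card (FX \<union> FY \<union> G)" by (intro card_mono)
  also have "\<dots> \<le> card FX + card FY + card G"
    using card_Un_le[of "FX \<union> FY" G] card_Un_le[of FX FY] by simp
  finally have sum: "real (card F) \<le> real (card FX) + real (card FY) + real (card C)" using G by simp
  define M where "M = max p q"
  have M: "p \<le> M" "q \<le> M" "1 \<le> M" "M = p \<or> M = q" using pq1 by (auto simp: M_def)
  have card_C: "real (card C) \<le> c * M"
    using cells unfolding C_def M_def p_def q_def by (simp add: of_nat_max)
  have lower: "9 / 4 * c * (M - 1) \<le> real (card F)" using M(4) card_F by auto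
  have wide: "real (card X) * (5 * c) \<le> M / 20 * (5 * c)" "real (card Y) * (5 * c) \<le> M / 20 * (5 * c)"
    using X Y M \<open>c \<ge> 1\<close> by (auto intro!: mult_right_mono)
  have "9 / 4 * c * (M - 1) \<le> 3 / 2 * (c * M)"
    using lower sum FX FY wide card_C by (simp add: algebra_simps)
  then have "c * (9 / 4 * (M - 1)) \<le> c * (3 / 2 * M)" by (simp add: algebra_simps)
  then have "9 / 4 * (M - 1) \<le> 3 / 2 * M" using \<open>c \<ge> 1\<close> by (subst (asm) mult_le_cancel_left_pos) auto
  then have "M \<le> 3" by simp
  then have "real (card X) < 1" "real (card Y) < 1" using X Y M by auto
  then have "card X = 0" "card Y = 0" by simp_all
  then have F_C: "real (card F) \<le> real (card C)" using sum FX FY by simp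
  then have "c * (9 / 4 * (M - 1)) \<le> c * M" using lower card_C by (simp add: algebra_simps)
  then have "9 / 4 * (M - 1) \<le> M" using \<open>c \<ge> 1\<close> by (subst (asm) mult_le_cancel_left_pos) auto
  then have "M < 2" by simp
  then have "length Is = 1" "length Js = 1" using M(1,2) pq1 by (auto simp: p_def q_def)
  then have "card (set Is \<times> set Js) \<le> 1"
    using card_length[of Is] card_length[of Js] mult_mono[of "card (set Is)" 1 "card (set Js)" 1]
    by (simp add: card_cartesian_product)
  moreover have "card C \<le> card (set Is \<times> set Js)"
    by (rule card_mono) (auto simp: C_def)
  ultimately show False using F_C \<open>card F \<ge> 2\<close> by simp
qed

lemma maybe_coarsen:
  assumes bal: "balanced f c P F Is" and "finite F" and "{} \<notin> F" and "c \<ge> 1"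
    and F: "9 / 4 * c * (real (length Is) - 1) \<le> real (card F) + 1"
  obtains Js where "balanced f c P F Js" and "9 / 4 * c * (real (length Js) - 1) \<le> real (card F)"
proof (cases "9 / 4 * c * (real (length Is) - 1) \<le> real (card F)")
  case True
  then show ?thesis using that bal by blast
next
  case False
  then obtain Js where Js: "balanced f c P F Js" "Suc (length Js) = length Is"
    using balanced_coarsen[OF bal assms(2,3)] \<open>c \<ge> 1\<close> by force
  then have "real (length Is) - 1 = real (length Js)" by linarith
  then have "9 / 4 * c * real (length Js) \<le> real (card F) + 1" using F by simp
  then have "9 / 4 * c * (real (length Js) - 1) \<le> real (card F)"
    using \<open>c \<ge> 1\<close> by (simp add: algebra_simps)
  then show ?thesis using that Js by blast
qed

lemma balanced_state_step:
  assumes st: "balanced_state c P F (Is, Js)" and "finite P" and "c \<ge> 1" and "card F \<ge> 2"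
    and cells: "real (card {(I, J) \<in> set Is \<times> set Js. (I \<times> J) \<inter> P \<noteq> {}})
      \<le> c * real (max (length Is) (length Js))"
  obtains F' G where "merge_step F F'" and "Suc (card F') = card F" and "balanced_state c P F' G"
proof -
  obtain R S I J where RS: "R \<in> F" "S \<in> F" "R \<noteq> S" and IJ: "I \<in> set Is" "J \<in> set Js"
    and sub: "R \<subseteq> I \<times> J" "S \<subseteq> I \<times> J"
    and ext: "extent I < 20 / real (length Is)" "extent J < 20 / real (length Js)"
    using exists_mergeable_pair[OF assms] .
  have F: "rectangle_family P F" and bI: "balanced fst c P F Is" and bJ: "balanced snd c P F Js"
    and card_F: "9 / 4 * c * (real (length Is) - 1) \<le> real (card F)"
      "9 / 4 * c * (real (length Js) - 1) \<le> real (card F)"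
    using st by (auto simp: balanced_state_def)
  have Is: "unit_partition Is" and Js: "unit_partition Js"
    using bI bJ by (auto simp: balanced_def)
  have fin: "finite F" using F by (simp add: rectangle_family_def)
  define B where "B = bounding_box (R \<union> S)"
  define F' where "F' = insert B (F - {R, S})"
  note merge = rectangle_family_merge[OF F RS, folded B_def, folded F'_def]
  have B: "B \<subseteq> I \<times> J"
  proof -
    obtain a b c d where R: "a \<le> b" "c \<le> d" "R = {a..b} \<times> {c..d}"
      using rectangle_familyE[OF F RS(1)] .
    obtain a' b' c' d' where S: "a' \<le> b'" "c' \<le> d'" "S = {a'..b'} \<times> {c'..d'}"
      using rectangle_familyE[OF F RS(2)] .
    show ?thesis
      unfolding B_def
      using bounding_box_subset_cell[OF R S] unit_partition_member(3)[OF Is IJ(1)]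
        unit_partition_member(3)[OF Js IJ(2)] sub by blast
  qed
  then have fst_B: "fst ` B \<subseteq> I" and snd_B: "snd ` B \<subseteq> J" by auto
  have "extent (fst ` B) \<le> extent I" "extent (snd ` B) \<le> extent J"
    using extent_mono[OF fst_B] extent_mono[OF snd_B] merge(3)
      unit_partition_member(4,5)[OF Is IJ(1)] unit_partition_member(4,5)[OF Js IJ(2)] by auto
  then have ext_B: "extent (fst ` B) < 20 / real (length Is)" "extent (snd ` B) < 20 / real (length Js)"
    using ext by auto
  have bI': "balanced fst c P F' Is"
    unfolding F'_def using fst_B sub ext_B merge(3)
    by (intro balanced_merge[OF bI fin RS IJ(1)]) auto
  have bJ': "balanced snd c P F' Js"
    unfolding F'_def using snd_B sub ext_B merge(3)
    by (intro balanced_merge[OF bJ fin RS IJ(2)]) auto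
  have F': "finite F'" "{} \<notin> F'"
    using fin rectangle_family_nonempty[OF merge(1)] by (simp_all add: F'_def)
  have card_F': "real (card F) = real (card F') + 1" using merge(2) by linarith
  obtain Is' where Is': "balanced fst c P F' Is'" "9 / 4 * c * (real (length Is') - 1) \<le> real (card F')"
    using maybe_coarsen[OF bI' F' \<open>c \<ge> 1\<close>] card_F(1) unfolding card_F' by blast
  obtain Js' where Js': "balanced snd c P F' Js'" "9 / 4 * c * (real (length Js') - 1) \<le> real (card F')"
    using maybe_coarsen[OF bJ' F' \<open>c \<ge> 1\<close>] card_F(2) unfolding card_F' by blast
  have "balanced_state c P F' (Is', Js')"
    using merge(1) Is' Js' by (simp add: balanced_state_def)
  moreover have "merge_step F F'"
    unfolding merge_step_def F'_def B_def using RS by blast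
  ultimately show ?thesis using that merge(2) by blast
qed

lemma balanced_singletons:
  fixes f :: "point \<Rightarrow> real"
  assumes "finite P" and "P \<noteq> {}" and inj: "inj_on f P" and "f ` P \<subseteq> {0..1}" and "c \<ge> 1"
  obtains Is where "balanced f c P ((\<lambda>p. {p}) ` P) Is"
    and "9 / 4 * c * (real (length Is) - 1) \<le> real (card P)"
proof -
  define m where "m = nat \<lfloor>5 * c\<rfloor>"
  have m: "real m \<le> 5 * c" "5 * c - 1 \<le> real m" "m > 0"
    using \<open>c \<ge> 1\<close> by (auto simp: m_def)
  obtain Is where Is: "unit_partition Is" "\<And>I. I \<in> set Is \<Longrightarrow> card (f ` P \<inter> I) \<le> m"
    and len: "(length Is - 1) * m \<le> card (f ` P)"
    using unit_partition_equitable[of "f ` P" m] assms m(3) by auto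
  have pts: "real (card {z \<in> P. f z \<in> I}) \<le> 5 * c" if "I \<in> set Is" for I
  proof -
    have "card {z \<in> P. f z \<in> I} = card (f ` {z \<in> P. f z \<in> I})"
      by (rule card_image[symmetric], rule inj_on_subset[OF inj]) auto
    also have "f ` {z \<in> P. f z \<in> I} = f ` P \<inter> I" by auto
    finally show ?thesis using Is(2)[OF that] m(1) by linarith
  qed
  have len1: "length Is \<ge> 1" by (rule unit_partition_nonempty[OF Is(1)])
  have "balanced f c P ((\<lambda>p. {p}) ` P) Is"
    unfolding balanced_def
  proof (intro conjI ballI impI)
    show "unit_partition Is" by (rule Is)
    fix R assume "R \<in> (\<lambda>p. {p}) ` P"
    then obtain z where z: "z \<in> P" "R = {z}" by auto
    then have "f z \<in> \<Union> (set Is)" using Is(1) assms(4) by (auto simp: unit_partition_def)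
    then show "\<exists>I\<in>set Is. f ` R \<subseteq> I" using z by auto
    show "extent (f ` R) < 20 / real (length Is)" using z len1 by (auto simp: extent_def)
  next
    fix I assume "I \<in> set Is"
    then show pts_I: "real (card {z \<in> P. f z \<in> I}) \<le> 5 * c" by (rule pts)
    have "{R \<in> (\<lambda>p. {p}) ` P. f ` R \<subseteq> I} = (\<lambda>p. {p}) ` {z \<in> P. f z \<in> I}" by auto
    then have "card {R \<in> (\<lambda>p. {p}) ` P. f ` R \<subseteq> I} = card {z \<in> P. f z \<in> I}"
      by (simp add: card_image)
    then show "real (card {R \<in> (\<lambda>p. {p}) ` P. f ` R \<subseteq> I}) \<le> 5 * c" using pts_I by simp
  qed
  moreover have "9 / 4 * c * (real (length Is) - 1) \<le> real (card P)"
  proof -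
    have "9 / 4 * c * (real (length Is) - 1) \<le> real m * (real (length Is) - 1)"
      using m(2) \<open>c \<ge> 1\<close> len1 by (intro mult_right_mono) auto
    also have "\<dots> = real ((length Is - 1) * m)" using len1 by (simp add: of_nat_diff)
    also have "\<dots> \<le> real (card P)" using len unfolding card_image[OF inj] of_nat_le_iff .
    finally show ?thesis .
  qed
  ultimately show ?thesis using that by blast
qed

lemma card_nonempty_cells_le:
  assumes F: "rectangle_family P F" and bal: "balanced f c P F Is"
    and cover: "\<forall>R\<in>F. \<exists>J\<in>\<J>. g ` R \<subseteq> J" and "I \<in> set Is"
    and disjoint: "\<And>J J' x. J \<in> \<J> \<Longrightarrow> J' \<in> \<J> \<Longrightarrow> x \<in> J \<Longrightarrow> x \<in> J' \<Longrightarrow> J = J'"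
  shows "real (card {J \<in> \<J>. \<exists>z\<in>P. f z \<in> I \<and> g z \<in> J}) \<le> 5 * c"
proof -
  have Is: "unit_partition Is" using bal by (simp add: balanced_def)
  obtain row where row: "\<And>R. R \<in> F \<Longrightarrow> row R \<in> \<J> \<and> g ` R \<subseteq> row R"
    using cover by metis
  have "{J \<in> \<J>. \<exists>z\<in>P. f z \<in> I \<and> g z \<in> J} \<subseteq> row ` {R \<in> F. f ` R \<subseteq> I}"
  proof clarify
    fix J z assume J: "J \<in> \<J>" "z \<in> P" "f z \<in> I" "g z \<in> J"
    obtain R where R: "R \<in> F" "z \<in> R" using F J(2) by (auto simp: rectangle_family_def)
    obtain I' where I': "I' \<in> set Is" "f ` R \<subseteq> I'" using bal R(1) by (auto simp: balanced_def)
    have "I' = I"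
      using unit_partition_unique[OF Is I'(1) \<open>I \<in> set Is\<close>, of "f z"] I'(2) R(2) J(3) by blast
    moreover have "J = row R"
      using disjoint[OF J(1) _ J(4)] row[OF R(1)] R(2) by blast
    ultimately show "J \<in> row ` {R \<in> F. f ` R \<subseteq> I}" using R(1) I'(2) by blast
  qed
  then have "card {J \<in> \<J>. \<exists>z\<in>P. f z \<in> I \<and> g z \<in> J} \<le> card {R \<in> F. f ` R \<subseteq> I}"
    using F by (intro surj_card_le) (auto simp: rectangle_family_def)
  moreover have "real (card {R \<in> F. f ` R \<subseteq> I}) \<le> 5 * c"
    using bal \<open>I \<in> set Is\<close> by (auto simp: balanced_def)
  ultimately show ?thesis by linarith
qed

lemma balanced_state_red_degree:
  assumes st: "balanced_state c P F G" and "R \<in> F"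
  shows "real (red_degree F R) < 10 * c"
proof -
  have F: "rectangle_family P F" and bI: "balanced fst c P F (fst G)" and bJ: "balanced snd c P F (snd G)"
    using st by (auto simp: balanced_state_def)
  have fin: "finite F" using F by (simp add: rectangle_family_def)
  have one_direction: "real (card {S \<in> F. S \<noteq> R \<and> f ` R \<inter> f ` S \<noteq> {}}) + 1 \<le> 5 * c"
    if bal: "balanced f c P F Is" for f Is
  proof -
    have Is: "unit_partition Is" using bal by (simp add: balanced_def)
    obtain I where I: "I \<in> set Is" "f ` R \<subseteq> I" using bal \<open>R \<in> F\<close> by (auto simp: balanced_def)
    let ?C = "{S \<in> F. f ` S \<subseteq> I}"
    have "{S \<in> F. S \<noteq> R \<and> f ` R \<inter> f ` S \<noteq> {}} \<subseteq> ?C - {R}"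
    proof
      fix S assume "S \<in> {S \<in> F. S \<noteq> R \<and> f ` R \<inter> f ` S \<noteq> {}}"
      then obtain x where S: "S \<in> F" "S \<noteq> R" "x \<in> f ` R" "x \<in> f ` S" by blast
      obtain I' where I': "I' \<in> set Is" "f ` S \<subseteq> I'" using bal S(1) by (auto simp: balanced_def)
      have "I' = I" using unit_partition_unique[OF Is I'(1) I(1), of x] S I I' by blast
      then show "S \<in> ?C - {R}" using S I' by blast
    qed
    then have "card {S \<in> F. S \<noteq> R \<and> f ` R \<inter> f ` S \<noteq> {}} \<le> card (?C - {R})"
      using fin by (intro card_mono) auto
    moreover have "Suc (card (?C - {R})) = card ?C"
      using fin \<open>R \<in> F\<close> I by (intro card_Suc_Diff1) auto
    moreover have "real (card ?C) \<le> 5 * c" using bal I(1) by (auto simp: balanced_def)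
    ultimately show ?thesis by linarith
  qed
  have "{S \<in> F. S \<noteq> R \<and> \<not> homogeneous R S} \<subseteq>
      {S \<in> F. S \<noteq> R \<and> fst ` R \<inter> fst ` S \<noteq> {}} \<union> {S \<in> F. S \<noteq> R \<and> snd ` R \<inter> snd ` S \<noteq> {}}"
    by (auto simp: homogeneous_def)
  then have "red_degree F R \<le>
      card ({S \<in> F. S \<noteq> R \<and> fst ` R \<inter> fst ` S \<noteq> {}} \<union> {S \<in> F. S \<noteq> R \<and> snd ` R \<inter> snd ` S \<noteq> {}})"
    unfolding red_degree_def using fin by (intro card_mono) auto
  also have "\<dots> \<le> card {S \<in> F. S \<noteq> R \<and> fst ` R \<inter> fst ` S \<noteq> {}} + card {S \<in> F. S \<noteq> R \<and> snd ` R \<inter> snd ` S \<noteq> {}}"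
    by (rule card_Un_le)
  finally show ?thesis using one_direction[OF bI] one_direction[OF bJ] by linarith
qed

lemma distance_balancedI:
  assumes st: "\<And>i. i \<in> {1..card P} \<Longrightarrow> balanced_state c P (\<R> i) (G i)"
    and card: "\<And>i. i \<in> {1..card P} \<Longrightarrow> card (\<R> i) + i = card P + 1"
    and "c > 0"
  shows "distance_balanced (10 * c) P \<R> G"
  unfolding distance_balanced_def Let_def
proof (intro ballI)
  fix i assume i: "i \<in> {1..card P}"
  define F Is Js where "F = \<R> i" and "Is = fst (G i)" and "Js = snd (G i)"
  have F: "rectangle_family P F" and bI: "balanced fst c P F Is" and bJ: "balanced snd c P F Js"
    and card_F: "9 / 4 * c * (real (length Is) - 1) \<le> real (card F)"
      "9 / 4 * c * (real (length Js) - 1) \<le> real (card F)"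
    using st[OF i] by (auto simp: balanced_state_def F_def Is_def Js_def)
  have fin: "finite F" using F by (simp add: rectangle_family_def)
  have Is: "unit_partition Is" and Js: "unit_partition Js"
    using bI bJ by (auto simp: balanced_def)
  have num: "real (card P) - real i + 1 = real (card F)" using card[OF i] by (simp add: F_def)
  have long: "real (card {z \<in> P. f z \<in> I}) \<le> 5 * c"
    if bal: "balanced f c P F Ks" and "I \<in> set Ks" "40 / real (length Ks) < extent I" for f Ks I
  proof -
    have "20 / real (length Ks) \<le> 40 / real (length Ks)" by (simp add: divide_right_mono)
    then have "20 / real (length Ks) \<le> extent I" using that(3) by simp
    then show ?thesis using bal that(2) by (auto simp: balanced_def)
  qed
  have max: "9 / 4 * c * (max (real (length Is)) (real (length Js)) - 1) \<le> real (card F)"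
    using card_F by (auto simp: max_def)
  have min: "real (card F) \<le> 5 * c * min (real (length Is)) (real (length Js))"
    using card_le_parts[OF bI fin] card_le_parts[OF bJ fin] by (auto simp: min_def)
  have cells: "\<exists>I\<in>set Is. \<exists>J\<in>set Js. R \<subseteq> I \<times> J" if R: "R \<in> F" for R
  proof -
    obtain I where I: "I \<in> set Is" "fst ` R \<subseteq> I" using bI R by (auto simp: balanced_def)
    obtain J where J: "J \<in> set Js" "snd ` R \<subseteq> J" using bJ R by (auto simp: balanced_def)
    have "R \<subseteq> I \<times> J" using I J by force
    then show ?thesis using I J by blast
  qed
  have col: "real (card {J \<in> set Js. (I \<times> J) \<inter> P \<noteq> {}}) \<le> 5 * c" if "I \<in> set Is" for I
  proof -
    have "{J \<in> set Js. (I \<times> J) \<inter> P \<noteq> {}} = {J \<in> set Js. \<exists>z\<in>P. fst z \<in> I \<and> snd z \<in> J}"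
      by (force simp: mem_Times_iff)
    then show ?thesis
      using card_nonempty_cells_le[OF F bI _ that, of "set Js" snd] bJ unit_partition_unique[OF Js]
      by (force simp: balanced_def)
  qed
  have row: "real (card {I \<in> set Is. (I \<times> J) \<inter> P \<noteq> {}}) \<le> 5 * c" if "J \<in> set Js" for J
  proof -
    have "{I \<in> set Is. (I \<times> J) \<inter> P \<noteq> {}} = {I \<in> set Is. \<exists>z\<in>P. snd z \<in> J \<and> fst z \<in> I}"
      by (force simp: mem_Times_iff)
    then show ?thesis
      using card_nonempty_cells_le[OF F bJ _ that, of "set Is" fst] bI unit_partition_unique[OF Is]
      by (force simp: balanced_def)
  qed
  have half: "10 * c / 2 = 5 * c" "1 / 2 * (10 * c) = 5 * c" "9 / 40 * (10 * c) = 9 / 4 * c" by simp_all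
  show "is_gridding (G i) \<and>
      (\<forall>I\<in>grid_columns (G i). real (card {J \<in> grid_rows (G i). I \<times> J \<inter> P \<noteq> {}}) \<le> 10 * c / 2) \<and>
      (\<forall>J\<in>grid_rows (G i). real (card {I \<in> grid_columns (G i). I \<times> J \<inter> P \<noteq> {}}) \<le> 10 * c / 2) \<and>
      (\<forall>R\<in>\<R> i. (\<exists>I\<in>grid_columns (G i). \<exists>J\<in>grid_rows (G i). R \<subseteq> I \<times> J) \<and>
          extent (fst ` R) < 20 / real (num_columns (G i)) \<and> extent (snd ` R) < 20 / real (num_rows (G i))) \<and>
      (\<forall>I\<in>grid_columns (G i). 40 / real (num_columns (G i)) < extent I \<longrightarrow>
          real (card {z \<in> P. fst z \<in> I}) \<le> 10 * c / 2) \<and>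
      (\<forall>J\<in>grid_rows (G i). 40 / real (num_rows (G i)) < extent J \<longrightarrow>
          real (card {z \<in> P. snd z \<in> J}) \<le> 10 * c / 2) \<and>
      9 / 40 * (10 * c) * (max (real (num_columns (G i))) (real (num_rows (G i))) - 1)
        \<le> real (card P) - real i + 1 \<and>
      real (card P) - real i + 1 \<le> 1 / 2 * (10 * c) * min (real (num_columns (G i))) (real (num_rows (G i)))"
    unfolding half num F_def[symmetric] Is_def[symmetric] Js_def[symmetric]
    using Is Js col row cells max min bI bJ long[OF bI] long[OF bJ]
    by (simp add: is_gridding_def balanced_def Is_def Js_def)
qed

lemma avoids_imp_length_ge_2:
  assumes "finite P" and "general_position P" and "avoids P k \<pi>" and "P \<noteq> {}"
  shows "k \<ge> 2"
proof (rule ccontr)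
  assume "\<not> k \<ge> 2"
  then have k: "i = 0" if "i < k" for i using that by linarith
  obtain p where "p \<in> P" using assms(4) by blast
  then have "\<not> avoids P k \<pi>"
  proof (rule order_embedding_imp_not_avoids[OF assms(1,2)])
    fix i j :: nat
    show "fst p < fst p" if "i < j" "j < k" using k[of j] that by simp
    show "snd p < snd p \<longleftrightarrow> \<pi> i < \<pi> j" if "i < k" "j < k" using k[of i] k[of j] that by simp
  qed
  with assms(3) show False by simp
qed

theorem theorem5p1:
  fixes \<pi> :: "nat \<Rightarrow> nat" and k n :: nat and P :: "(real \<times> real) set"
  assumes "\<pi> permutes {..<k}"
    and "P \<subseteq> {0..1} \<times> {0..1}"
    and "finite P" and "card P = n"
    and "general_position P"
    and "avoids P k \<pi>"
  shows "\<exists>\<R> G. merge_sequence P \<R> \<and>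
           wide (10 * fh_limit k \<pi>) P \<R> \<and>
           distance_balanced (10 * fh_limit k \<pi>) P \<R> G"
proof (cases "P = {}")
  case True
  define \<R> :: "nat \<Rightarrow> point set set" where "\<R> = (\<lambda>i. if i = 0 then {{}} else {})"
  have "merge_sequence P \<R>" "wide d P \<R>" "distance_balanced d P \<R> G" for d G
    using True by (simp_all add: merge_sequence_def wide_def distance_balanced_def \<R>_def)
  then show ?thesis by blast
next
  case False
  define c where "c = fh_limit k \<pi>"
  have k: "k \<ge> 2" by (rule avoids_imp_length_ge_2[OF assms(3,5,6) False])
  have c: "c \<ge> 1" unfolding c_def by (rule fh_limit_ge_1[OF assms(1) k])
  have n: "n > 0" using assms(3,4) False by (metis card_gt_0_iff)
  have cells: "real (card {(I, J) \<in> set Is \<times> set Js. (I \<times> J) \<inter> P \<noteq> {}})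
      \<le> c * real (max (length Is) (length Js))"
    if "unit_partition Is" "unit_partition Js" for Is Js
    using card_nonempty_cells[OF that assms(3,5,1,6)]
      ex_perm_le_fh_limit[OF assms(1) k, of "max (length Is) (length Js)"]
    unfolding c_def by linarith
  define good where "good m x \<longleftrightarrow> (m < n \<longrightarrow>
      balanced_state c P (fst x) (snd x) \<and> card (fst x) + m = n \<and> (m = 0 \<longrightarrow> fst x = (\<lambda>p. {p}) ` P))"
    for m and x :: "point set set \<times> gridding"
  define step where "step m x y \<longleftrightarrow> (Suc m < n \<longrightarrow> merge_step (fst x) (fst y))"
    for m :: nat and x y :: "point set set \<times> gridding"
  have "\<exists>x. good 0 x"
  proof -
    have inj: "inj_on fst P" "inj_on snd P" using assms(5) by (auto simp: general_position_def)
    have unit: "fst ` P \<subseteq> {0..1}" "snd ` P \<subseteq> {0..1}" using assms(2) by auto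
    obtain Is where Is: "balanced fst c P ((\<lambda>p. {p}) ` P) Is" "9 / 4 * c * (real (length Is) - 1) \<le> real (card P)"
      using balanced_singletons[OF assms(3) False inj(1) unit(1) c] .
    obtain Js where Js: "balanced snd c P ((\<lambda>p. {p}) ` P) Js" "9 / 4 * c * (real (length Js) - 1) \<le> real (card P)"
      using balanced_singletons[OF assms(3) False inj(2) unit(2) c] .
    have "is_rectangle {z}" for z
      unfolding is_rectangle_def by (intro exI[of _ "fst z"] exI[of _ "snd z"]) auto
    then have "rectangle_family P ((\<lambda>p. {p}) ` P)"
      unfolding rectangle_family_def using assms(3) inj(1) by (auto simp: inj_on_def)
    moreover have "card ((\<lambda>p. {p}) ` P) = card P" by (simp add: card_image)
    ultimately show ?thesis
      using Is Js assms(4) by (intro exI[of _ "((\<lambda>p. {p}) ` P, (Is, Js))"]) (simp add: good_def balanced_state_def)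
  qed
  moreover have "\<exists>y. good (Suc m) y \<and> step m x y" if x: "good m x" for m x
  proof (cases "Suc m < n")
    case True
    obtain F Is Js where F: "x = (F, (Is, Js))" by (metis prod.exhaust)
    have st: "balanced_state c P F (Is, Js)" "card F + m = n"
      using x True by (auto simp: good_def F)
    then have "unit_partition Is" "unit_partition Js"
      by (auto simp: balanced_state_def balanced_def)
    then obtain F' G where "merge_step F F'" "Suc (card F') = card F" "balanced_state c P F' G"
      using balanced_state_step[OF st(1) assms(3) c _ cells] st(2) True by (metis add_le_cancel_right add_2_eq_Suc Suc_leI)
    then have "good (Suc m) (F', G)" "step m x (F', G)"
      using st(2) by (auto simp: good_def step_def F)
    then show ?thesis by blast
  qed (auto simp: good_def step_def)
  ultimately obtain h where h: "\<And>m. good m (h m) \<and> step m (h m) (h (Suc m))"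
    using dependent_nat_choice[of good step] by blast
  define \<R> G where "\<R> i = fst (h (i - 1))" and "G i = snd (h (i - 1))" for i
  have state: "balanced_state c P (\<R> i) (G i)" "card (\<R> i) + i = card P + 1" if "i \<in> {1..card P}" for i
    using h[of "i - 1"] that assms(4) by (auto simp: good_def \<R>_def G_def)
  have "merge_sequence P \<R>"
    unfolding merge_sequence_def
  proof (intro conjI ballI)
    show "\<R> 1 = (\<lambda>p. {p}) ` P" using h[of 0] n by (simp add: good_def \<R>_def)
    have "card (\<R> (card P)) = 1" using state(2)[of "card P"] n assms(4) by simp
    then show "\<exists>R. \<R> (card P) = {R}" by (rule card_1_singletonE) blast
    fix i assume i: "i \<in> {1..<card P}"
    then show "merge_step (\<R> i) (\<R> (Suc i))"
      using h[of "i - 1"] assms(4) by (simp add: step_def \<R>_def)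
  qed
  moreover have "wide (10 * c) P \<R>"
    unfolding wide_def using balanced_state_red_degree[OF state(1)] by blast
  moreover have "distance_balanced (10 * c) P \<R> G"
    using state c by (intro distance_balancedI) auto
  ultimately show ?thesis unfolding c_def by blast
qed

end
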